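(* Let $(\Omega,g)$ be a 3-dimensional Riemannian manifold and $c>0$ a constant. For functionals $F,G$ of $(\tilde{\boldsymbol{d}}^2,\boldsymbol{b}^2)$, where $\tilde{\boldsymbol{d}}^2=\mathbf{i}_{\boldsymbol{D}}\mathrm{vol}^3$ and $\boldsymbol{b}^2=\mathbf{i}_{\boldsymbol{B}}\mathrm{vol}^3$, let $$\{F,G\}=4\pi c\left[\left\langle\frac{\tilde\delta F}{\delta\tilde{\boldsymbol{d}}^2},\mathsf{d}\frac{\tilde\delta G}{\delta\boldsymbol{b}^2}\right\rangle-\left\langle\frac{\tilde\delta G}{\delta\tilde{\boldsymbol{d}}^2},\mathsf{d}\frac{\tilde\delta F}{\delta\boldsymbol{b}^2}\right\rangle\right].$$ In local coordinates $(x^1,x^2,x^3)$ on $\Omega$ write $\frac{\tilde\delta F}{\delta\tilde{\boldsymbol{d}}^2}=\frac{\delta F}{\delta D^i}\mathsf{d}x^i$ and $\frac{\tilde\delta F}{\delta\boldsymbol{b}^2}=\frac{\delta F}{\delta B^i}\mathsf{d}x^i$ (and likewise for $G$), with summation over repeated indices. Then $$\{F,G\}=4\pi c\int_\Omega\left(\frac{\delta F}{\delta D^i}\frac{\partial}{\partial x^j}\Big(\frac{\delta G}{\delta B^k}\Big)-\frac{\delta G}{\delta D^i}\frac{\partial}{\partial x^j}\Big(\frac{\delta F}{\delta B^k}\Big)\right)\mathsf{d}x^i\wedge\mathsf{d}x^j\wedge\mathsf{d}x^k .$$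
   Context: $\Lambda^k$ denotes straight differential $k$-forms and $\tilde\Lambda^k$ twisted $k$-forms (which additionally change sign under orientation-reversing coordinate changes; the orientation factor is suppressed in coordinate expressions); $\mathsf{d}$ is the exterior derivative and $\mathbf{i}_V$ the interior product. The volume form $\mathrm{vol}^3$ is twisted. $\boldsymbol{D}$ is a vector field, so $\tilde{\boldsymbol{d}}^2\in\tilde\Lambda^2$; $\boldsymbol{B}$ is a pseudovector field, so $\boldsymbol{b}^2\in\Lambda^2$ is straight. Pairing: $\langle\omega^k,\tilde\eta^{3-k}\rangle=\int_\Omega\omega^k\wedge\tilde\eta^{3-k}$. Twisted functional derivatives $\frac{\tilde\delta F}{\delta\tilde{\boldsymbol{d}}^2}\in\Lambda^1$ and $\frac{\tilde\delta F}{\delta\boldsymbol{b}^2}\in\tilde\Lambda^1$ are defined by $$DF[\tilde{\boldsymbol{d}}^2,\boldsymbol{b}^2](\delta\tilde{\boldsymbol{d}}^2,\delta\boldsymbol{b}^2)=\int_\Omega\frac{\tilde\delta F}{\delta\tilde{\boldsymbol{d}}^2}\wedge\delta\tilde{\boldsymbol{d}}^2+\int_\Omega\delta\boldsymbol{b}^2\wedge\frac{\tilde\delta F}{\delta\boldsymbol{b}^2}.$$ The coefficients $\frac{\delta F}{\delta D^i}$, $\frac{\delta F}{\delta B^i}$ are the covector components of the vector-field functional derivatives $\frac{\delta F}{\delta\boldsymbol{D}}$, $\frac{\delta F}{\delta\boldsymbol{B}}$ (taken with respect to the $L^2$ inner product of vector fields), i.e. $\frac{\tilde\delta F}{\delta\tilde{\boldsymbol{d}}^2}=(\frac{\delta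 F}{\delta\boldsymbol{D}})^\flat$ and $\frac{\tilde\delta F}{\delta\boldsymbol{b}^2}=(\frac{\delta F}{\delta\boldsymbol{B}})^\flat$. The integral is understood over the region covered by the coordinate chart (globally, as an integral of a form given locally by this expression). Functionals are assumed differentiable with sufficiently regular functional derivatives. *)

theory Defs
  imports "HOL-Analysis.Analysis"
begin

section \<open>Smooth maps between open sets\<close>

definition partial_deriv :: "'n::finite \<Rightarrow> (real^'n \<Rightarrow> 'b::real_normed_vector) \<Rightarrow> real^'n \<Rightarrow> 'b" where
  "partial_deriv j f x = frechet_derivative f (at x) (axis j 1)"

text \<open>For open sets this is the usual class of infinitely differentiable maps: all iterated
  partial derivatives are required to be differentiable, and hence they are all continuous.\<close>
definition smooth_on :: "(real^'n::finite) set \<Rightarrow> (real^'n \<Rightarrow> 'b::real_normed_vector) \<Rightarrow> bool" where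
  "smooth_on S f \<longleftrightarrow> (\<forall>js. \<forall>x\<in>S. foldr partial_deriv js f differentiable (at x))"


section \<open>Riemannian 3-manifolds\<close>

record 'a chart =
  cdom :: "'a set"
  cmap :: "'a \<Rightarrow> real^3"

abbreviation cimg :: "'a chart \<Rightarrow> (real^3) set" where
  "cimg \<kappa> \<equiv> cmap \<kappa> ` cdom \<kappa>"

text \<open>The metric is given by its matrix \<open>g\<^sub>i\<^sub>j\<close> in each chart.\<close>
record 'a manifold3 =
  mtop :: "'a topology"
  atlas :: "'a chart set"
  gmat :: "'a chart \<Rightarrow> real^3 \<Rightarrow> real^3^3"

definition transition :: "'a chart \<Rightarrow> 'a chart \<Rightarrow> real^3 \<Rightarrow> real^3" where
  "transition \<kappa> \<kappa>' = cmap \<kappa>' \<circ> inv_into (cdom \<kappa>) (cmap \<kappa>)"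

definition jacobian :: "'a chart \<Rightarrow> 'a chart \<Rightarrow> real^3 \<Rightarrow> real^3 \<Rightarrow> real^3" where
  "jacobian \<kappa> \<kappa>' x = frechet_derivative (transition \<kappa> \<kappa>') (at x)"

definition smooth_manifold3 :: "('a, 'z) manifold3_scheme \<Rightarrow> bool" where
  "smooth_manifold3 M \<longleftrightarrow>
     Hausdorff_space (mtop M) \<and> second_countable (mtop M) \<and>
     (\<Union>\<kappa>\<in>atlas M. cdom \<kappa>) = topspace (mtop M) \<and>
     (\<forall>\<kappa>\<in>atlas M. openin (mtop M) (cdom \<kappa>) \<and> open (cimg \<kappa>) \<and>
        homeomorphic_map (subtopology (mtop M) (cdom \<kappa>)) (top_of_set (cimg \<kappa>)) (cmap \<kappa>)) \<and>
     (\<forall>\<kappa>\<in>atlas M. \<forall>\<kappa>'\<in>atlas M.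
        smooth_on (cmap \<kappa> ` (cdom \<kappa> \<inter> cdom \<kappa>')) (transition \<kappa> \<kappa>'))"

definition riemannian_manifold3 :: "('a, 'z) manifold3_scheme \<Rightarrow> bool" where
  "riemannian_manifold3 M \<longleftrightarrow>
     smooth_manifold3 M \<and>
     (\<forall>\<kappa>\<in>atlas M. smooth_on (cimg \<kappa>) (gmat M \<kappa>) \<and>
        (\<forall>x\<in>cimg \<kappa>. transpose (gmat M \<kappa> x) = gmat M \<kappa> x \<and>
           (\<forall>v. v \<noteq> 0 \<longrightarrow> v \<bullet> (gmat M \<kappa> x *v v) > 0))) \<and>
     (\<forall>\<kappa>\<in>atlas M. \<forall>\<kappa>'\<in>atlas M. \<forall>p\<in>cdom \<kappa> \<inter> cdom \<kappa>'. \<forall>v w.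
        v \<bullet> (gmat M \<kappa> (cmap \<kappa> p) *v w) =
          jacobian \<kappa> \<kappa>' (cmap \<kappa> p) v \<bullet> (gmat M \<kappa>' (cmap \<kappa>' p) *v jacobian \<kappa> \<kappa>' (cmap \<kappa> p) w))"


section \<open>Alternating forms on a coordinate space\<close>

text \<open>A \<open>k\<close>-form at a point is a function of lists of tangent vectors which vanishes on lists
  of length other than \<open>k\<close>.\<close>
type_synonym alt_form = "(real^3) list \<Rightarrow> real"

definition alternating :: "nat \<Rightarrow> alt_form \<Rightarrow> bool" where
  "alternating k \<eta> \<longleftrightarrow>
     (\<forall>vs. length vs \<noteq> k \<longrightarrow> \<eta> vs = 0) \<and>
     (\<forall>vs i. length vs = k \<and> i < k \<longrightarrow> linear (\<lambda>v. \<eta> (vs[i := v]))) \<and>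
     (\<forall>vs i j. length vs = k \<and> i < j \<and> j < k \<and> vs ! i = vs ! j \<longrightarrow> \<eta> vs = 0)"

definition wedge :: "nat \<Rightarrow> nat \<Rightarrow> alt_form \<Rightarrow> alt_form \<Rightarrow> alt_form" where
  "wedge k l \<alpha> \<beta> vs =
     (if length vs = k + l then
        (\<Sum>\<sigma> | \<sigma> permutes {..<k+l}. of_int (sign \<sigma>)
            * \<alpha> (map (\<lambda>i. vs ! \<sigma> i) [0..<k]) * \<beta> (map (\<lambda>i. vs ! \<sigma> i) [k..<k+l]))
          / (fact k * fact l)
      else 0)"

definition dx :: "3 \<Rightarrow> alt_form" where
  "dx i vs = (if length vs = 1 then hd vs $ i else 0)"

definition dxdxdx :: "3 \<Rightarrow> 3 \<Rightarrow> 3 \<Rightarrow> alt_form" where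
  "dxdxdx i j k = wedge 2 1 (wedge 1 1 (dx i) (dx j)) (dx k)"

definition coefficient3 :: "alt_form \<Rightarrow> real" where
  "coefficient3 \<eta> = \<eta> [axis 1 1, axis 2 1, axis 3 1]"


section \<open>Straight and twisted fields on a manifold\<close>

text \<open>Tensor fields are families of coordinate expressions, one for each chart of the atlas,
  related by the transformation law. The coordinate expression of a twisted object
  omits the orientation factor, which therefore appears in the transformation law.\<close>
datatype parity = Straight | Twisted

definition orient :: "parity \<Rightarrow> (real^3 \<Rightarrow> real^3) \<Rightarrow> real" where
  "orient s J = (case s of Straight \<Rightarrow> 1 | Twisted \<Rightarrow> sgn (det (matrix J)))"

type_synonym 'a form_field = "'a chart \<Rightarrow> real^3 \<Rightarrow> alt_form"
type_synonym 'a vector_field = "'a chart \<Rightarrow> real^3 \<Rightarrow> real^3"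

text \<open>The space of smooth \<open>k\<close>-forms. Values outside the range of the charts are fixed to be zero,
  so that a form is determined by its coordinate expressions.\<close>
definition forms :: "('a, 'z) manifold3_scheme \<Rightarrow> parity \<Rightarrow> nat \<Rightarrow> 'a form_field set" where
  "forms M s k = {\<omega>.
     (\<forall>\<kappa> x. \<not> (\<kappa> \<in> atlas M \<and> x \<in> cimg \<kappa>) \<longrightarrow> \<omega> \<kappa> x = (\<lambda>_. 0)) \<and>
     (\<forall>\<kappa>\<in>atlas M. \<forall>x\<in>cimg \<kappa>. alternating k (\<omega> \<kappa> x)) \<and>
     (\<forall>\<kappa>\<in>atlas M. \<forall>vs. smooth_on (cimg \<kappa>) (\<lambda>x. \<omega> \<kappa> x vs)) \<and>
     (\<forall>\<kappa>\<in>atlas M. \<forall>\<kappa>'\<in>atlas M. \<forall>p\<in>cdom \<kappa> \<inter> cdom \<kappa>'. \<forall>vs.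
        \<omega> \<kappa> (cmap \<kappa> p) vs =
          orient s (jacobian \<kappa> \<kappa>' (cmap \<kappa> p))
            * \<omega> \<kappa>' (cmap \<kappa>' p) (map (jacobian \<kappa> \<kappa>' (cmap \<kappa> p)) vs))}"

text \<open>Vector fields for \<open>s = Straight\<close>, pseudovector fields for \<open>s = Twisted\<close>.\<close>
definition vector_fields :: "('a, 'z) manifold3_scheme \<Rightarrow> parity \<Rightarrow> 'a vector_field set" where
  "vector_fields M s = {V.
     (\<forall>\<kappa>\<in>atlas M. smooth_on (cimg \<kappa>) (V \<kappa>)) \<and>
     (\<forall>\<kappa>\<in>atlas M. \<forall>\<kappa>'\<in>atlas M. \<forall>p\<in>cdom \<kappa> \<inter> cdom \<kappa>'.
        V \<kappa>' (cmap \<kappa>' p) =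
          orient s (jacobian \<kappa> \<kappa>' (cmap \<kappa> p)) *\<^sub>R jacobian \<kappa> \<kappa>' (cmap \<kappa> p) (V \<kappa> (cmap \<kappa> p)))}"

text \<open>The field with given coordinate expressions.\<close>
definition local_form :: "('a, 'z) manifold3_scheme \<Rightarrow> 'a form_field \<Rightarrow> 'a form_field" where
  "local_form M e \<kappa> x = (if \<kappa> \<in> atlas M \<and> x \<in> cimg \<kappa> then e \<kappa> x else (\<lambda>_. 0))"

definition vol3 :: "('a, 'z) manifold3_scheme \<Rightarrow> 'a form_field" where
  "vol3 M = local_form M (\<lambda>\<kappa> x vs. sqrt (det (gmat M \<kappa> x)) * dxdxdx 1 2 3 vs)"

definition interior_prod :: "'a vector_field \<Rightarrow> 'a form_field \<Rightarrow> 'a form_field" where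
  "interior_prod V \<omega> \<kappa> x vs = \<omega> \<kappa> x (V \<kappa> x # vs)"

definition wedge_form :: "nat \<Rightarrow> nat \<Rightarrow> 'a form_field \<Rightarrow> 'a form_field \<Rightarrow> 'a form_field" where
  "wedge_form k l \<omega> \<eta> \<kappa> x = wedge k l (\<omega> \<kappa> x) (\<eta> \<kappa> x)"

text \<open>The invariant formula on constant vector fields:
  \<open>d\<omega>(v\<^sub>0, \<dots>, v\<^sub>k)\<close> is the alternating sum of the derivatives in direction \<open>v\<^sub>i\<close> of \<open>\<omega>\<close>
  evaluated on the remaining vectors.\<close>
definition ext_deriv :: "('a, 'z) manifold3_scheme \<Rightarrow> 'a form_field \<Rightarrow> 'a form_field" where
  "ext_deriv M \<omega> = local_form M (\<lambda>\<kappa> x vs.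
     \<Sum>i<length vs. (- 1) ^ i *
       frechet_derivative (\<lambda>y. \<omega> \<kappa> y (take i vs @ drop (Suc i) vs)) (at x) (vs ! i))"

definition compactly_supported :: "('a, 'z) manifold3_scheme \<Rightarrow> 'a form_field \<Rightarrow> bool" where
  "compactly_supported M \<omega> \<longleftrightarrow>
     (\<exists>K. compactin (mtop M) K \<and>
        (\<forall>\<kappa>\<in>atlas M. \<forall>p\<in>cdom \<kappa> - K. \<omega> \<kappa> (cmap \<kappa> p) = (\<lambda>_. 0)))"


section \<open>Integration of twisted 3-forms\<close>

text \<open>In one chart, the integral over a region \<open>A\<close> of its domain is the Lebesgue integral of the
  coefficient of \<open>dx\<^sup>1 \<and> dx\<^sup>2 \<and> dx\<^sup>3\<close>.\<close>
definition chart_integrable :: "'a chart \<Rightarrow> 'a set \<Rightarrow> 'a form_field \<Rightarrow> bool" where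
  "chart_integrable \<kappa> A \<omega> \<longleftrightarrow>
     set_integrable lebesgue (cmap \<kappa> ` A) (\<lambda>x. coefficient3 (\<omega> \<kappa> x))"

definition chart_integral :: "'a chart \<Rightarrow> 'a set \<Rightarrow> 'a form_field \<Rightarrow> real" where
  "chart_integral \<kappa> A \<omega> = (LINT x:cmap \<kappa> ` A|lebesgue. coefficient3 (\<omega> \<kappa> x))"

text \<open>Globally, the manifold is cut into countably many disjoint Borel pieces, each inside the
  domain of a chart. Since a twisted 3-form transforms with the absolute value of the Jacobian
  determinant, neither integrability nor the value of the integral depends on the sequence of
  charts that is chosen, and no orientation is needed.\<close>
definition chart_cover :: "('a, 'z) manifold3_scheme \<Rightarrow> nat \<Rightarrow> 'a chart" where
  "chart_cover M =
     (SOME C. range C \<subseteq> atlas M \<and> (\<Union>n. cdom (C n)) = topspace (mtop M))"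

definition piece :: "('a, 'z) manifold3_scheme \<Rightarrow> nat \<Rightarrow> 'a set" where
  "piece M = disjointed (\<lambda>n. cdom (chart_cover M n))"

definition form_integrable :: "('a, 'z) manifold3_scheme \<Rightarrow> 'a set \<Rightarrow> 'a form_field \<Rightarrow> bool" where
  "form_integrable M A \<omega> \<longleftrightarrow>
     (\<forall>n. chart_integrable (chart_cover M n) (A \<inter> piece M n) \<omega>) \<and>
     summable (\<lambda>n. chart_integral (chart_cover M n) (A \<inter> piece M n) (\<lambda>\<kappa> x vs. \<bar>\<omega> \<kappa> x vs\<bar>))"

definition form_integral :: "('a, 'z) manifold3_scheme \<Rightarrow> 'a set \<Rightarrow> 'a form_field \<Rightarrow> real" where
  "form_integral M A \<omega> =
     (\<Sum>n. chart_integral (chart_cover M n) (A \<inter> piece M n) \<omega>)"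

text \<open>The pairing of a \<open>k\<close>-form with a \<open>(3-k)\<close>-form over the region \<open>A\<close>.\<close>
definition pairing_on ::
    "('a, 'z) manifold3_scheme \<Rightarrow> 'a set \<Rightarrow> nat \<Rightarrow> 'a form_field \<Rightarrow> 'a form_field \<Rightarrow> real" where
  "pairing_on M A k \<omega> \<eta> = form_integral M A (wedge_form k (3 - k) \<omega> \<eta>)"

abbreviation pairing ::
    "('a, 'z) manifold3_scheme \<Rightarrow> nat \<Rightarrow> 'a form_field \<Rightarrow> 'a form_field \<Rightarrow> real" where
  "pairing M \<equiv> pairing_on M (topspace (mtop M))"


section \<open>Functional derivatives and the bracket\<close>

text \<open>A functional of a twisted 2-form and a straight 2-form; only its values on such forms
  matter.\<close>
type_synonym 'a functional = "'a form_field \<Rightarrow> 'a form_field \<Rightarrow> real"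

definition vary :: "'a form_field \<Rightarrow> real \<Rightarrow> 'a form_field \<Rightarrow> 'a form_field" where
  "vary \<omega> \<epsilon> \<delta> = (\<lambda>\<kappa> x vs. \<omega> \<kappa> x vs + \<epsilon> * \<delta> \<kappa> x vs)"

text \<open>The pair \<open>(\<alpha>, \<beta>)\<close> represents the derivative of \<open>F\<close> at \<open>(d, b)\<close> in the direction of all
  compactly supported variations.\<close>
definition has_functional_derivs ::
    "('a, 'z) manifold3_scheme \<Rightarrow> 'a functional \<Rightarrow> 'a form_field \<Rightarrow> 'a form_field
      \<Rightarrow> 'a form_field \<Rightarrow> 'a form_field \<Rightarrow> bool" where
  "has_functional_derivs M F d b \<alpha> \<beta> \<longleftrightarrow>
     \<alpha> \<in> forms M Straight 1 \<and> \<beta> \<in> forms M Twisted 1 \<and>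
     (\<forall>\<delta>d\<in>forms M Twisted 2. \<forall>\<delta>b\<in>forms M Straight 2.
        compactly_supported M \<delta>d \<and> compactly_supported M \<delta>b \<longrightarrow>
        ((\<lambda>\<epsilon>. F (vary d \<epsilon> \<delta>d) (vary b \<epsilon> \<delta>b))
           has_real_derivative (pairing M 1 \<alpha> \<delta>d + pairing M 2 \<delta>b \<beta>)) (at 0))"

definition functionally_differentiable ::
    "('a, 'z) manifold3_scheme \<Rightarrow> 'a functional \<Rightarrow> 'a form_field \<Rightarrow> 'a form_field \<Rightarrow> bool" where
  "functionally_differentiable M F d b \<longleftrightarrow> (\<exists>\<alpha> \<beta>. has_functional_derivs M F d b \<alpha> \<beta>)"

text \<open>By the fundamental lemma of the calculus of variations there is at most one such pair.\<close>
definition functional_derivs ::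
    "('a, 'z) manifold3_scheme \<Rightarrow> 'a functional \<Rightarrow> 'a form_field \<Rightarrow> 'a form_field
      \<Rightarrow> 'a form_field \<times> 'a form_field" where
  "functional_derivs M F d b = (SOME p. has_functional_derivs M F d b (fst p) (snd p))"

definition deriv_d ::
    "('a, 'z) manifold3_scheme \<Rightarrow> 'a functional \<Rightarrow> 'a form_field \<Rightarrow> 'a form_field \<Rightarrow> 'a form_field"
  where "deriv_d M F d b = fst (functional_derivs M F d b)"

definition deriv_b ::
    "('a, 'z) manifold3_scheme \<Rightarrow> 'a functional \<Rightarrow> 'a form_field \<Rightarrow> 'a form_field \<Rightarrow> 'a form_field"
  where "deriv_b M F d b = snd (functional_derivs M F d b)"

text \<open>The bracket with both integrals extended over the region \<open>A\<close>.\<close>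
definition bracket_on ::
    "('a, 'z) manifold3_scheme \<Rightarrow> 'a set \<Rightarrow> real \<Rightarrow> 'a functional \<Rightarrow> 'a functional
      \<Rightarrow> 'a form_field \<Rightarrow> 'a form_field \<Rightarrow> real" where
  "bracket_on M A c F G d b =
     4 * pi * c *
       (pairing_on M A 1 (deriv_d M F d b) (ext_deriv M (deriv_b M G d b))
        - pairing_on M A 1 (deriv_d M G d b) (ext_deriv M (deriv_b M F d b)))"

abbreviation bracket ::
    "('a, 'z) manifold3_scheme \<Rightarrow> real \<Rightarrow> 'a functional \<Rightarrow> 'a functional
      \<Rightarrow> 'a form_field \<Rightarrow> 'a form_field \<Rightarrow> real" where
  "bracket M \<equiv> bracket_on M (topspace (mtop M))"

text \<open>The coordinate expression \<open>u\<^sub>i dx\<^sup>i\<close> of a 1-form in the chart \<open>\<kappa>\<close>.\<close>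
definition has_components ::
    "'a form_field \<Rightarrow> 'a chart \<Rightarrow> (3 \<Rightarrow> real^3 \<Rightarrow> real) \<Rightarrow> bool" where
  "has_components \<omega> \<kappa> u \<longleftrightarrow> (\<forall>x\<in>cimg \<kappa>. \<omega> \<kappa> x = (\<lambda>vs. \<Sum>i\<in>UNIV. u i x * dx i vs))"

end

theory Submission
  imports Defs
begin

text \<open>The coordinate formula comes from \<open>\<alpha> \<and> d\<beta> = \<alpha>\<^sub>i \<partial>\<^sub>j \<beta>\<^sub>k dx\<^sup>i \<and> dx\<^sup>j \<and> dx\<^sup>k\<close> for 1-forms
  \<open>\<alpha>\<close> and \<open>\<beta>\<close>. The transformation law of \<open>\<alpha> \<and> d\<beta>\<close> reduces to \<open>d\<close> commuting with pullback
  along the transition maps, and that reduces to the symmetry of second partial derivatives; the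
  orientation factor of the twisted form \<open>\<beta>\<close> is locally constant and so passes through \<open>d\<close>.
  Because twisted 3-forms transform with the absolute value of the Jacobian determinant, the
  integral over the domain of any chart may be evaluated in that chart.\<close>

section \<open>Smooth functions and symmetry of second derivatives\<close>

text \<open>The global formula and the formula in a chart have different sources. Globally,
  \<open>\<theta>\<close> is the difference of two wedge forms and \<open>form_integral\<close> is
  linear on integrable families, whatever charts \<open>chart_cover\<close> selects. Over the domain
  of a chart \<open>\<kappa>\<close>, \<open>form_integral\<close> still measures each piece in the
  chart selected for that piece, so every piece has to be carried to \<open>\<kappa>\<close> before
  the pieces can be glued; the summability of absolute integrals in \<open>form_integrable\<close>
  is what permits the gluing. On the analytic side the obstacle is that \<open>smooth_on\<close>
  constrains derivatives only at points of the set, while the functions are total and arbitrary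
  elsewhere. Closure properties are therefore argued up to equality on an open set. Continuity of a
  derivative is always drawn from its differentiability, one order higher.\<close>

lemma smooth_on_imp_differentiable:
  "smooth_on S f \<Longrightarrow> x \<in> S \<Longrightarrow> f differentiable (at x)"
  unfolding smooth_on_def by (metis foldr.simps(1) id_apply)

lemma smooth_on_partial_deriv:
  assumes "smooth_on S f"
  shows "smooth_on S (partial_deriv j f)"
  unfolding smooth_on_def
proof (intro allI ballI)
  fix js x assume "x \<in> S"
  with assms have "foldr partial_deriv (js @ [j]) f differentiable (at x)"
    unfolding smooth_on_def by blast
  then show "foldr partial_deriv js (partial_deriv j f) differentiable (at x)"
    by simp
qed

section \<open>Locality of derivatives and closure properties of smoothness\<close>

lemma differentiable_cong_open:
  assumes "open S" "x \<in> S" "\<And>y. y \<in> S \<Longrightarrow> f y = g y"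
  shows "f differentiable (at x) \<longleftrightarrow> g differentiable (at x)"
  unfolding differentiable_def
  using has_derivative_transform_within_open[OF _ assms(1,2)] assms(3) by metis

lemma frechet_derivative_cong_open:
  assumes "open S" "x \<in> S" "\<And>y. y \<in> S \<Longrightarrow> f y = g y"
  shows "frechet_derivative f (at x) = frechet_derivative g (at x)"
proof -
  have "(f has_derivative f') (at x) \<longleftrightarrow> (g has_derivative f') (at x)" for f'
    using has_derivative_transform_within_open[OF _ assms(1,2)] assms(3) by metis
  then show ?thesis by (simp add: frechet_derivative_def)
qed

lemma partial_deriv_cong_open:
  assumes "open S" "x \<in> S" "\<And>y. y \<in> S \<Longrightarrow> f y = g y"
  shows "partial_deriv j f x = partial_deriv j g x"
  unfolding partial_deriv_def using frechet_derivative_cong_open[OF assms] by simp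

text \<open>A direct induction on the list of indices would need a formula for every iterated
  derivative; a class of functions closed under a single derivative replaces it. Closure is asked
  only up to equality on \<open>S\<close>: openness makes derivatives at points of \<open>S\<close>
  depend on the values in \<open>S\<close> alone.\<close>

lemma smooth_on_coinduct:
  assumes "open S" and "P f"
    and diff: "\<And>f x. P f \<Longrightarrow> x \<in> S \<Longrightarrow> f differentiable (at x)"
    and pd: "\<And>f j. P f \<Longrightarrow> \<exists>g. P g \<and> (\<forall>x\<in>S. partial_deriv j f x = g x)"
  shows "smooth_on S f"
proof -
  have *: "\<exists>g. P g \<and> (\<forall>x\<in>S. foldr partial_deriv js f x = g x)" for js
  proof (induction js)
    case Nil
    then show ?case using \<open>P f\<close> by auto
  next
    case (Cons j js)
    then obtain g where g: "P g" "\<forall>x\<in>S. foldr partial_deriv js f x = g x" by blast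
    obtain h where h: "P h" "\<forall>x\<in>S. partial_deriv j g x = h x" using pd[OF g(1)] by blast
    have "foldr partial_deriv (j # js) f x = h x" if "x \<in> S" for x
      using partial_deriv_cong_open[OF \<open>open S\<close> that, of "foldr partial_deriv js f" g] g(2) h(2) that
      by simp
    then show ?case using h(1) by blast
  qed
  show ?thesis
    unfolding smooth_on_def
  proof (intro allI ballI)
    fix js x assume "x \<in> S"
    obtain g where "P g" "\<And>x. x \<in> S \<Longrightarrow> foldr partial_deriv js f x = g x" using * by blast
    then show "foldr partial_deriv js f differentiable (at x)"
      using differentiable_cong_open[OF \<open>open S\<close> \<open>x \<in> S\<close>, of "foldr partial_deriv js f" g]
        diff[OF _ \<open>x \<in> S\<close>] by blast
  qed
qed

lemma smooth_on_cong:
  assumes "open S" "smooth_on S f" "\<And>x. x \<in> S \<Longrightarrow> f x = g x"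
  shows "smooth_on S g"
proof (rule smooth_on_coinduct[where P = "\<lambda>g. \<exists>f. smooth_on S f \<and> (\<forall>x\<in>S. f x = g x)"])
  show "\<exists>f. smooth_on S f \<and> (\<forall>x\<in>S. f x = g x)" using assms by blast
next
  fix g :: "real^'a \<Rightarrow> 'b" and x
  assume "\<exists>f. smooth_on S f \<and> (\<forall>x\<in>S. f x = g x)" "x \<in> S"
  then show "g differentiable (at x)"
    using differentiable_cong_open[OF assms(1), of x _ g] smooth_on_imp_differentiable by blast
next
  fix g :: "real^'a \<Rightarrow> 'b" and j
  assume "\<exists>f. smooth_on S f \<and> (\<forall>x\<in>S. f x = g x)"
  then obtain f where f: "smooth_on S f" "\<And>x. x\<in>S \<Longrightarrow> f x = g x" by blast
  then show "\<exists>h. (\<exists>f. smooth_on S f \<and> (\<forall>x\<in>S. f x = h x)) \<and> (\<forall>x\<in>S. partial_deriv j g x = h x)"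
    using partial_deriv_cong_open[OF assms(1), of _ f g j] f(2) smooth_on_partial_deriv[OF f(1)]
    by (intro exI[of _ "partial_deriv j f"]) auto
qed (fact assms(1))

lemma smooth_on_const: "open S \<Longrightarrow> smooth_on S (\<lambda>_. c)"
  by (rule smooth_on_coinduct[where P = "\<lambda>f. \<exists>c. f = (\<lambda>_. c)"])
    (auto simp: partial_deriv_def frechet_derivative_const)

text \<open>The derivative of a product is a sum of products, so smoothness of products is proved for the
  whole algebra generated by the smooth functions at once.\<close>
inductive smooth_algebra :: "(real^'n::finite) set \<Rightarrow> (real^'n \<Rightarrow> real) \<Rightarrow> bool" for S where
  base: "smooth_on S f \<Longrightarrow> smooth_algebra S f"
| add: "smooth_algebra S f \<Longrightarrow> smooth_algebra S g \<Longrightarrow> smooth_algebra S (\<lambda>x. f x + g x)"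
| mult: "smooth_algebra S f \<Longrightarrow> smooth_algebra S g \<Longrightarrow> smooth_algebra S (\<lambda>x. f x * g x)"

lemma smooth_algebra_differentiable:
  "smooth_algebra S f \<Longrightarrow> x \<in> S \<Longrightarrow> f differentiable (at x)"
  by (induction rule: smooth_algebra.induct)
    (auto intro: smooth_on_imp_differentiable differentiable_add differentiable_mult)

lemma partial_deriv_add:
  assumes "f differentiable (at x)" "g differentiable (at x)"
  shows "partial_deriv j (\<lambda>x. f x + g x) x = partial_deriv j f x + partial_deriv j g x"
  using has_derivative_add[OF assms[unfolded frechet_derivative_works]]
  by (simp add: partial_deriv_def frechet_derivative_at[symmetric])

lemma partial_deriv_mult:
  fixes f g :: "real^'n::finite \<Rightarrow> real"
  assumes "f differentiable (at x)" "g differentiable (at x)"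
  shows "partial_deriv j (\<lambda>x. f x * g x) x = f x * partial_deriv j g x + partial_deriv j f x * g x"
  using has_derivative_mult[OF assms[unfolded frechet_derivative_works]]
  by (simp add: partial_deriv_def frechet_derivative_at[symmetric])

lemma smooth_algebra_partial_deriv:
  "smooth_algebra S f \<Longrightarrow> \<exists>g. smooth_algebra S g \<and> (\<forall>x\<in>S. partial_deriv j f x = g x)"
proof (induction rule: smooth_algebra.induct)
  case (base f)
  then show ?case using smooth_algebra.base smooth_on_partial_deriv by blast
next
  case (add f g)
  then obtain f' g' where "smooth_algebra S f'" "\<forall>x\<in>S. partial_deriv j f x = f' x"
    "smooth_algebra S g'" "\<forall>x\<in>S. partial_deriv j g x = g' x" by blast
  then show ?case
    using add.hyps
    by (intro exI[of _ "\<lambda>x. f' x + g' x"])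
      (auto intro: smooth_algebra.intros simp: partial_deriv_add smooth_algebra_differentiable)
next
  case (mult f g)
  then obtain f' g' where "smooth_algebra S f'" "\<forall>x\<in>S. partial_deriv j f x = f' x"
    "smooth_algebra S g'" "\<forall>x\<in>S. partial_deriv j g x = g' x" by blast
  then show ?case
    using mult.hyps
    by (intro exI[of _ "\<lambda>x. f x * g' x + f' x * g x"])
      (auto intro: smooth_algebra.intros simp: partial_deriv_mult smooth_algebra_differentiable)
qed

lemma smooth_algebra_imp_smooth_on:
  "open S \<Longrightarrow> smooth_algebra S f \<Longrightarrow> smooth_on S f"
  by (rule smooth_on_coinduct[where P = "smooth_algebra S"])
    (assumption | rule smooth_algebra_differentiable smooth_algebra_partial_deriv)+

lemma smooth_on_add:
  fixes f g :: "real^'n::finite \<Rightarrow> real"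
  assumes "open S" "smooth_on S f" "smooth_on S g"
  shows "smooth_on S (\<lambda>x. f x + g x)"
  using assms by (simp add: smooth_algebra_imp_smooth_on smooth_algebra.intros)

lemma smooth_on_mult:
  fixes f g :: "real^'n::finite \<Rightarrow> real"
  assumes "open S" "smooth_on S f" "smooth_on S g"
  shows "smooth_on S (\<lambda>x. f x * g x)"
  using assms by (simp add: smooth_algebra_imp_smooth_on smooth_algebra.intros)

lemma smooth_on_diff:
  fixes f g :: "real^'n::finite \<Rightarrow> real"
  assumes "open S" "smooth_on S f" "smooth_on S g"
  shows "smooth_on S (\<lambda>x. f x - g x)"
  using smooth_on_add[OF assms(1,2) smooth_on_mult[OF assms(1) smooth_on_const[OF assms(1), of "-1"] assms(3)]]
  by simp

lemma smooth_on_sum: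
  fixes f :: "'i \<Rightarrow> real^'n::finite \<Rightarrow> real"
  assumes "open S" "\<And>i. i \<in> I \<Longrightarrow> smooth_on S (f i)"
  shows "smooth_on S (\<lambda>x. \<Sum>i\<in>I. f i x)"
  using assms(2)
  by (induction I rule: infinite_finite_induct)
    (auto intro: smooth_on_add smooth_on_const assms(1))

section \<open>Partial derivatives in coordinates and the symmetry of second derivatives\<close>

lemma frechet_derivative_eq_sum_partial_deriv:
  assumes "f differentiable (at x)"
  shows "frechet_derivative f (at x) v = (\<Sum>i\<in>UNIV. v $ i *\<^sub>R partial_deriv i f x)"
proof -
  have "linear (frechet_derivative f (at x))" by (rule linear_frechet_derivative[OF assms])
  then have "frechet_derivative f (at x) (\<Sum>i\<in>UNIV. v $ i *\<^sub>R axis i 1)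
      = (\<Sum>i\<in>UNIV. v $ i *\<^sub>R partial_deriv i f x)"
    unfolding partial_deriv_def by (simp add: linear_sum linear_cmul)
  moreover have "(\<Sum>i\<in>UNIV. v $ i *\<^sub>R axis i 1) = v"
    using basis_expansion[of v] by (simp add: scalar_mult_eq_scaleR)
  ultimately show ?thesis by simp
qed

lemma partial_deriv_vec_nth:
  fixes f :: "real^'n::finite \<Rightarrow> real^'m::finite"
  assumes "f differentiable (at x)"
  shows "partial_deriv j (\<lambda>x. f x $ k) x = partial_deriv j f x $ k"
proof -
  have "((\<lambda>x. f x $ k) has_derivative (\<lambda>v. frechet_derivative f (at x) v $ k)) (at x)"
    using assms[unfolded frechet_derivative_works]
    by (rule bounded_linear.has_derivative[OF bounded_linear_vec_nth])
  then show ?thesis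
    unfolding partial_deriv_def by (simp add: frechet_derivative_at[symmetric])
qed

text \<open>The algebra of smooth functions is real-valued, so transition maps enter it through
  their components. The invariant is stable because taking a component commutes with
  \<open>partial_deriv\<close>.\<close>

lemma smooth_on_vec_nth:
  fixes f :: "real^'n::finite \<Rightarrow> real^'m::finite"
  assumes "open S" "smooth_on S f"
  shows "smooth_on S (\<lambda>x. f x $ k)"
proof (rule smooth_on_coinduct[where P = "\<lambda>h. \<exists>f::real^'n \<Rightarrow> real^'m. smooth_on S f \<and> h = (\<lambda>x. f x $ k)"])
  show "\<exists>f'::real^'n \<Rightarrow> real^'m. smooth_on S f' \<and> (\<lambda>x. f x $ k) = (\<lambda>x. f' x $ k)"
    using assms(2) by blast
next
  fix h x assume "\<exists>f::real^'n \<Rightarrow> real^'m. smooth_on S f \<and> h = (\<lambda>x. f x $ k)" "x \<in> S"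
  then obtain f :: "real^'n \<Rightarrow> real^'m" where "h = (\<lambda>x. f x $ k)" "f differentiable (at x)"
    using smooth_on_imp_differentiable by blast
  then show "h differentiable (at x)"
    unfolding differentiable_def by (auto intro: bounded_linear.has_derivative[OF bounded_linear_vec_nth])
next
  fix h j assume "\<exists>f::real^'n \<Rightarrow> real^'m. smooth_on S f \<and> h = (\<lambda>x. f x $ k)"
  then obtain f :: "real^'n \<Rightarrow> real^'m" where f: "smooth_on S f" "h = (\<lambda>x. f x $ k)" by blast
  show "\<exists>g. (\<exists>f::real^'n \<Rightarrow> real^'m. smooth_on S f \<and> g = (\<lambda>x. f x $ k)) \<and> (\<forall>x\<in>S. partial_deriv j h x = g x)"
    using smooth_on_partial_deriv[OF f(1)] f
    by (intro exI[of _ "\<lambda>x. partial_deriv j f x $ k"])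
      (auto simp: partial_deriv_vec_nth smooth_on_imp_differentiable)
qed (fact assms(1))

text \<open>Restriction to a line parallel to an axis opens partial derivatives to the one-variable
  mean value theorem.\<close>

lemma has_real_derivative_along_axis:
  fixes f :: "real^'n::finite \<Rightarrow> real"
  assumes "f differentiable (at (p + s *\<^sub>R axis j 1))"
  shows "((\<lambda>s. f (p + s *\<^sub>R axis j 1)) has_real_derivative partial_deriv j f (p + s *\<^sub>R axis j 1)) (at s)"
proof -
  let ?y = "p + s *\<^sub>R axis j 1"
  have "((\<lambda>s. p + s *\<^sub>R axis j 1) has_derivative (\<lambda>t. t *\<^sub>R axis j 1)) (at s)"
    by (auto intro!: derivative_eq_intros)
  from diff_chain_at[OF this assms[unfolded frechet_derivative_works]]
  have "((\<lambda>s. f (p + s *\<^sub>R axis j 1)) has_derivative (\<lambda>t. frechet_derivative f (at ?y) (t *\<^sub>R axis j 1))) (at s)"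
    by (simp add: o_def)
  moreover have "frechet_derivative f (at ?y) (t *\<^sub>R axis j 1) = partial_deriv j f ?y * t" for t
    using linear_cmul[OF linear_frechet_derivative[OF assms], of t "axis j 1"]
    by (simp add: partial_deriv_def)
  ultimately show ?thesis by (simp add: has_field_derivative_def)
qed

text \<open>Two mean value theorems, one along each axis, evaluate the second difference over a
  square of side \<open>h\<close>. The left side is symmetric in \<open>i\<close> and
  \<open>j\<close> up to the order of its terms, while the right side names an order of
  differentiation; reading it both ways is what gives symmetry.\<close>

lemma mixed_difference_eq:
  fixes f :: "real^'n::finite \<Rightarrow> real"
  assumes "smooth_on (ball x e) f" "0 < h" "2 * h < e"
  shows "\<exists>y. dist y x \<le> 2 * h \<and>
    f (x + h *\<^sub>R axis i 1 + h *\<^sub>R axis j 1) - f (x + h *\<^sub>R axis i 1) - f (x + h *\<^sub>R axis j 1) + f x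
      = h * (h * partial_deriv j (partial_deriv i f) y)"
proof -
  have near: "dist (x + s *\<^sub>R axis i 1 + t *\<^sub>R axis j 1) x \<le> 2 * h"
    if "0 \<le> s" "s \<le> h" "0 \<le> t" "t \<le> h" for s t
  proof -
    have "norm (s *\<^sub>R axis i (1::real) + t *\<^sub>R axis j 1) \<le> norm (s *\<^sub>R axis i (1::real)) + norm (t *\<^sub>R axis j (1::real))"
      by (rule norm_triangle_ineq)
    also have "\<dots> \<le> 2 * h" using that by (simp add: norm_axis_1)
    finally show ?thesis by (simp add: dist_norm add.assoc)
  qed
  have inball: "x + s *\<^sub>R axis i 1 + t *\<^sub>R axis j 1 \<in> ball x e"
    if "0 \<le> s" "s \<le> h" "0 \<le> t" "t \<le> h" for s t
    using near[OF that] assms(3) by (simp add: dist_commute)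
  note df = smooth_on_imp_differentiable[OF assms(1)]
    and di = smooth_on_imp_differentiable[OF smooth_on_partial_deriv[OF assms(1)]]
  \<comment> \<open>The second difference is the increment of \<open>?\<phi>\<close> over
    \<open>[0, h]\<close>, and the derivative of \<open>?\<phi>\<close> at the intermediate point is
    again an increment, that of \<open>?\<psi>\<close> below.\<close>
  let ?\<phi> = "\<lambda>s. f (x + h *\<^sub>R axis j 1 + s *\<^sub>R axis i 1) - f (x + s *\<^sub>R axis i 1)"
  let ?\<phi>' = "\<lambda>s. partial_deriv i f (x + h *\<^sub>R axis j 1 + s *\<^sub>R axis i 1) - partial_deriv i f (x + s *\<^sub>R axis i 1)"
  have "(?\<phi> has_real_derivative ?\<phi>' s) (at s)" if "0 \<le> s" "s \<le> h" for s
    using inball[OF that, of h] inball[OF that, of 0] assms(2)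
    by (intro DERIV_diff has_real_derivative_along_axis df) (simp_all add: add.commute add.left_commute)
  from MVT2[OF assms(2) this] obtain \<xi> where \<xi>: "0 < \<xi>" "\<xi> < h" "?\<phi> h - ?\<phi> 0 = h * ?\<phi>' \<xi>"
    by auto
  let ?\<psi> = "\<lambda>t. partial_deriv i f (x + \<xi> *\<^sub>R axis i 1 + t *\<^sub>R axis j 1)"
  have "(?\<psi> has_real_derivative partial_deriv j (partial_deriv i f) (x + \<xi> *\<^sub>R axis i 1 + t *\<^sub>R axis j 1)) (at t)"
    if "0 \<le> t" "t \<le> h" for t
    using inball[of \<xi> t] \<xi> that by (intro has_real_derivative_along_axis di) simp_all
  from MVT2[OF assms(2) this] obtain \<eta> where \<eta>: "0 < \<eta>" "\<eta> < h"
    "?\<psi> h - ?\<psi> 0 = h * partial_deriv j (partial_deriv i f) (x + \<xi> *\<^sub>R axis i 1 + \<eta> *\<^sub>R axis j 1)"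
    by auto
  have "?\<phi>' \<xi> = ?\<psi> h - ?\<psi> 0" by (simp add: add.commute add.left_commute)
  with \<xi> \<eta> near[of \<xi> \<eta>] show ?thesis
    by (intro exI[of _ "x + \<xi> *\<^sub>R axis i 1 + \<eta> *\<^sub>R axis j 1"])
      (simp add: add.commute add.left_commute)
qed

text \<open>For every small \<open>h\<close> the same second difference, divided by
  \<open>h * h\<close>, is a value of either mixed derivative at some point near \<open>x\<close>.
  Both mixed derivatives are continuous at \<open>x\<close>, being differentiable there.\<close>

theorem partial_deriv_commute:
  fixes f :: "real^'n::finite \<Rightarrow> real"
  assumes "open S" "smooth_on S f" "x \<in> S"
  shows "partial_deriv i (partial_deriv j f) x = partial_deriv j (partial_deriv i f) x"
proof -
  let ?A = "partial_deriv j (partial_deriv i f)" and ?B = "partial_deriv i (partial_deriv j f)"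
  obtain e where e: "e > 0" "ball x e \<subseteq> S" using assms openE by blast
  have sm: "smooth_on (ball x e) f" using assms(2) e(2) unfolding smooth_on_def by blast
  have "isCont ?A x" "isCont ?B x"
    using assms smooth_on_partial_deriv smooth_on_imp_differentiable
      differentiable_imp_continuous_within by blast+
  then have cont: "\<exists>d>0. \<forall>y. dist y x < d \<longrightarrow> dist (?A y) (?A x) < r"
    "\<exists>d>0. \<forall>y. dist y x < d \<longrightarrow> dist (?B y) (?B x) < r" if "r > 0" for r
    using that unfolding continuous_at_eps_delta by blast+
  have "dist (?A x) (?B x) < r" if r: "r > 0" for r
  proof -
    obtain d1 d2 where d: "d1 > 0" "d2 > 0"
      "\<And>y. dist y x < d1 \<Longrightarrow> dist (?A y) (?A x) < r/2"
      "\<And>y. dist y x < d2 \<Longrightarrow> dist (?B y) (?B x) < r/2"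
      using cont[OF half_gt_zero[OF r]] by blast
    \<comment> \<open>The divisor 3 keeps \<open>2 * h\<close>, the bound on the distance of the
      intermediate points from \<open>x\<close>, strictly below all three radii.\<close>
    define h where "h = min e (min d1 d2) / 3"
    have h: "h > 0" "2 * h < e" "2 * h < d1" "2 * h < d2" using d(1,2) e(1) by (auto simp: h_def)
    obtain y where y: "dist y x \<le> 2 * h"
      "f (x + h *\<^sub>R axis i 1 + h *\<^sub>R axis j 1) - f (x + h *\<^sub>R axis i 1) - f (x + h *\<^sub>R axis j 1) + f x = h * (h * ?A y)"
      using mixed_difference_eq[OF sm h(1,2)] by blast
    obtain z where z: "dist z x \<le> 2 * h"
      "f (x + h *\<^sub>R axis j 1 + h *\<^sub>R axis i 1) - f (x + h *\<^sub>R axis j 1) - f (x + h *\<^sub>R axis i 1) + f x = h * (h * ?B z)"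
      using mixed_difference_eq[OF sm h(1,2)] by blast
    have "h * (h * ?A y) = h * (h * ?B z)"
      unfolding y(2)[symmetric] z(2)[symmetric] by (simp add: add.commute add.left_commute)
    then have "?A y = ?B z" using h(1) by simp
    moreover have "dist (?A y) (?A x) < r/2" "dist (?B z) (?B x) < r/2"
      using d y(1) z(1) h by auto
    ultimately show ?thesis unfolding dist_real_def by linarith
  qed
  from this[of "dist (?A x) (?B x)"] show ?thesis by (metis less_irrefl zero_less_dist_iff)
qed

section \<open>Alternating forms\<close>

text \<open>With \<open>f\<close> arbitrary, the expansion fits the summand of \<open>wedge\<close>
  for any choice of the two factors.\<close>

lemma sum_permutes_lessThan_2:
  fixes f :: "nat \<Rightarrow> nat \<Rightarrow> real"
  shows "(\<Sum>\<sigma> | \<sigma> permutes {..<2::nat}. of_int (sign \<sigma>) * f (\<sigma> 0) (\<sigma> 1)) = f 0 1 - f 1 0"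
proof -
  have eq: "{..<2::nat} = insert 0 {1}" by auto
  show ?thesis
    unfolding eq
    by (subst sum_over_permutations_insert)
      (simp_all add: sign_swap_id permutes_sing sign_compose)
qed

lemma sum_permutes_lessThan_3:
  fixes f :: "nat \<Rightarrow> nat \<Rightarrow> nat \<Rightarrow> real"
  shows "(\<Sum>\<sigma> | \<sigma> permutes {..<3::nat}. of_int (sign \<sigma>) * f (\<sigma> 0) (\<sigma> 1) (\<sigma> 2))
    = f 0 1 2 - f 0 2 1 - f 1 0 2 + f 1 2 0 + f 2 0 1 - f 2 1 0"
proof -
  have eq: "{..<3::nat} = insert 0 (insert 1 {2})" by auto
  have f012: "finite {1::nat, 2}" "0 \<notin> {1::nat, 2}" and f12: "finite {2::nat}" "1 \<notin> {2::nat}" by auto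
  show ?thesis
    unfolding eq sum_over_permutations_insert[OF f012] sum_over_permutations_insert[OF f12] permutes_sing
    by (simp add: sign_swap_id sign_compose permutation_swap_id transpose_def)
qed

section \<open>Wedge products in low degrees\<close>

lemma wedge_1_1:
  "wedge 1 1 \<alpha> \<beta> [u, v] = \<alpha> [u] * \<beta> [v] - \<alpha> [v] * \<beta> [u]"
  using sum_permutes_lessThan_2[of "\<lambda>i j. \<alpha> [[u, v] ! i] * \<beta> [[u, v] ! j]"]
  by (simp add: wedge_def upt_rec mult.assoc numeral_2_eq_2)

text \<open>Antisymmetry joins the six permutation terms into three equal pairs, which cancels the
  factor \<open>fact 2 * fact 1\<close> in \<open>wedge\<close>.\<close>

lemma wedge_2_1:
  assumes "\<And>x y. \<alpha> [y, x] = - \<alpha> [x, y]"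
  shows "wedge 2 1 \<alpha> \<beta> [u, v, w] = \<alpha> [u, v] * \<beta> [w] - \<alpha> [u, w] * \<beta> [v] + \<alpha> [v, w] * \<beta> [u]"
  using sum_permutes_lessThan_3[of "\<lambda>i j k. \<alpha> [[u, v, w] ! i, [u, v, w] ! j] * \<beta> [[u, v, w] ! k]"]
    assms[of u v] assms[of u w] assms[of v w]
  by (simp add: wedge_def upt_rec mult.assoc numeral_3_eq_3 numeral_2_eq_2)

lemma wedge_1_2:
  assumes "\<And>x y. \<beta> [y, x] = - \<beta> [x, y]"
  shows "wedge 1 2 \<alpha> \<beta> [u, v, w] = \<alpha> [u] * \<beta> [v, w] - \<alpha> [v] * \<beta> [u, w] + \<alpha> [w] * \<beta> [u, v]"
  using sum_permutes_lessThan_3[of "\<lambda>i j k. \<alpha> [[u, v, w] ! i] * \<beta> [[u, v, w] ! j, [u, v, w] ! k]"]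
    assms[of u v] assms[of u w] assms[of v w]
  by (simp add: wedge_def upt_rec mult.assoc numeral_3_eq_3 numeral_2_eq_2)

text \<open>The right side is the Leibniz expansion of the determinant of the coordinates
  \<open>i\<close>, \<open>j\<close>, \<open>k\<close> of the three vectors, valid for repeated
  indices as well.\<close>

lemma dxdxdx_eq:
  "dxdxdx i j k [u, v, w] = u$i * v$j * w$k - u$i * w$j * v$k - v$i * u$j * w$k
     + v$i * w$j * u$k + w$i * u$j * v$k - w$i * v$j * u$k"
  unfolding dxdxdx_def
  by (subst wedge_2_1) (simp_all add: wedge_1_1[simplified] dx_def algebra_simps)

section \<open>Alternating 3-forms and determinants\<close>

lemma alternating_linear:
  "alternating k \<eta> \<Longrightarrow> length vs = k \<Longrightarrow> i < k \<Longrightarrow> linear (\<lambda>v. \<eta> (vs[i := v]))"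
  unfolding alternating_def by blast

lemma alternating_eq_0:
  "alternating k \<eta> \<Longrightarrow> length vs = k \<Longrightarrow> i < j \<Longrightarrow> j < k \<Longrightarrow> vs ! i = vs ! j \<Longrightarrow> \<eta> vs = 0"
  unfolding alternating_def by blast

lemma length_3_cases:
  assumes "length vs = 3"
  obtains u v w where "vs = [u, v, w]"
  using assms by (auto simp: numeral_3_eq_3 length_Suc_conv)

lemma alternating_3I:
  assumes len: "\<And>vs. length vs \<noteq> 3 \<Longrightarrow> \<eta> vs = 0"
    and lin: "\<And>v w. linear (\<lambda>z. \<eta> [z, v, w])" "\<And>u w. linear (\<lambda>z. \<eta> [u, z, w])"
      "\<And>u v. linear (\<lambda>z. \<eta> [u, v, z])"
    and eq0: "\<And>u w. \<eta> [u, u, w] = 0" "\<And>u w. \<eta> [u, w, u] = 0" "\<And>u w. \<eta> [w, u, u] = 0"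
  shows "alternating 3 \<eta>"
  unfolding alternating_def
proof (intro conjI allI impI; (elim conjE)?)
  fix vs :: "(real^3) list" and i :: nat
  assume vs: "length vs = 3" and i: "i < 3"
  obtain u v w where "vs = [u, v, w]" using length_3_cases[OF vs] .
  moreover have "i = 0 \<or> i = 1 \<or> i = 2" using i by auto
  ultimately show "linear (\<lambda>v. \<eta> (vs[i := v]))" using lin by auto
next
  fix vs :: "(real^3) list" and i j :: nat
  assume vs: "length vs = 3" and ij: "i < j" "j < 3" and eq: "vs ! i = vs ! j"
  obtain u v w where "vs = [u, v, w]" using length_3_cases[OF vs] .
  moreover have "i = 0 \<and> j = 1 \<or> i = 0 \<and> j = 2 \<or> i = 1 \<and> j = 2" using ij by auto
  ultimately show "\<eta> vs = 0" using eq eq0 by auto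
qed (fact len)

lemma alternating_diff:
  assumes "alternating k \<eta>" "alternating k \<zeta>"
  shows "alternating k (\<lambda>vs. \<eta> vs - \<zeta> vs)"
  using assms unfolding alternating_def by (auto intro!: linear_compose_sub)

lemma linear_real_eq_sum_axis:
  fixes f :: "real^'n::finite \<Rightarrow> real"
  assumes "linear f"
  shows "f v = (\<Sum>i\<in>UNIV. v $ i * f (axis i 1))"
proof -
  have "f (\<Sum>i\<in>UNIV. v $ i *\<^sub>R axis i 1) = (\<Sum>i\<in>UNIV. v $ i * f (axis i 1))"
    using assms by (simp add: linear_sum linear_cmul)
  moreover have "(\<Sum>i\<in>UNIV. v $ i *\<^sub>R axis i 1) = v"
    using basis_expansion[of v] by (simp add: scalar_mult_eq_scaleR)
  ultimately show ?thesis by simp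
qed

lemma alternating_1_eq_sum:
  assumes "alternating 1 \<eta>"
  shows "\<eta> [v] = (\<Sum>i\<in>UNIV. v $ i * \<eta> [axis i 1])"
proof (rule linear_real_eq_sum_axis)
  show "linear (\<lambda>v. \<eta> [v])" using alternating_linear[OF assms, of "[v]" 0] by simp
qed

text \<open>Polarization: expand the form on a sum of two vectors inserted twice, where it
  vanishes.\<close>

lemma alternating_3_swap:
  assumes "alternating 3 \<eta>"
  shows "\<eta> [v, u, w] = - \<eta> [u, v, w]" "\<eta> [u, w, v] = - \<eta> [u, v, w]"
proof -
  have lin: "linear (\<lambda>x. \<eta> [x, y, z])" "linear (\<lambda>x. \<eta> [y, x, z])" "linear (\<lambda>x. \<eta> [y, z, x])" for y z
    using alternating_linear[OF assms, of "[y, y, z]" 0] alternating_linear[OF assms, of "[y, y, z]" 1]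
      alternating_linear[OF assms, of "[y, z, z]" 2] by simp_all
  have z: "\<eta> [x, x, y] = 0" "\<eta> [y, x, x] = 0" for x y
    using alternating_eq_0[OF assms, of "[x, x, y]" 0 1] alternating_eq_0[OF assms, of "[y, x, x]" 1 2]
    by simp_all
  have "\<eta> [u + v, u + v, w] = \<eta> [u, u, w] + \<eta> [u, v, w] + \<eta> [v, u, w] + \<eta> [v, v, w]"
    by (simp add: linear_add[OF lin(1)] linear_add[OF lin(2)])
  then show "\<eta> [v, u, w] = - \<eta> [u, v, w]" by (simp add: z)
  have "\<eta> [u, v + w, v + w] = \<eta> [u, v, v] + \<eta> [u, v, w] + \<eta> [u, w, v] + \<eta> [u, w, w]"
    by (simp add: linear_add[OF lin(3)] linear_add[OF lin(2)])
  then show "\<eta> [u, w, v] = - \<eta> [u, v, w]" by (simp add: z)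
qed

text \<open>Expansion over the standard basis has 27 terms. Those with a repeated basis vector
  vanish, and the other six carry the signs of the Leibniz formula. This is where the Jacobian
  determinant of a change of chart comes from.\<close>

lemma alternating_3_eq_det:
  assumes "alternating 3 \<eta>" "linear J"
  shows "\<eta> [J (axis 1 1), J (axis 2 1), J (axis 3 1)] = det (matrix J) * coefficient3 \<eta>"
proof -
  have lin: "linear (\<lambda>x. \<eta> [x, y, z])" "linear (\<lambda>x. \<eta> [y, x, z])" "linear (\<lambda>x. \<eta> [y, z, x])" for y z
    using alternating_linear[OF assms(1), of "[y, y, z]" 0] alternating_linear[OF assms(1), of "[y, y, z]" 1]
      alternating_linear[OF assms(1), of "[y, z, z]" 2] by simp_all
  have z: "\<eta> [x, x, y] = 0" "\<eta> [y, x, x] = 0" "\<eta> [x, y, x] = 0" for x y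
    using alternating_eq_0[OF assms(1), of "[x, x, y]" 0 1] alternating_eq_0[OF assms(1), of "[y, x, x]" 1 2]
      alternating_eq_0[OF assms(1), of "[x, y, x]" 0 2]
    by simp_all
  let ?e = "\<lambda>i::3. axis i (1::real)"
  define c where "c = \<eta> [?e 1, ?e 2, ?e 3]"
  have perm: "\<eta> [?e 1, ?e 3, ?e 2] = - c" "\<eta> [?e 2, ?e 1, ?e 3] = - c" "\<eta> [?e 2, ?e 3, ?e 1] = c"
    "\<eta> [?e 3, ?e 1, ?e 2] = c" "\<eta> [?e 3, ?e 2, ?e 1] = - c"
    unfolding c_def using alternating_3_swap[OF assms(1)] by (metis add.inverse_inverse)+
  have expand: "\<eta> [u, v, w] = (\<Sum>i\<in>UNIV. u $ i * (\<Sum>j\<in>UNIV. v $ j * (\<Sum>k\<in>UNIV. w $ k * \<eta> [?e i, ?e j, ?e k])))" for u v w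
  proof -
    have "\<eta> [u, v, w] = (\<Sum>i\<in>UNIV. u $ i * \<eta> [?e i, v, w])"
      by (rule linear_real_eq_sum_axis[OF lin(1)])
    also have "\<dots> = (\<Sum>i\<in>UNIV. u $ i * (\<Sum>j\<in>UNIV. v $ j * \<eta> [?e i, ?e j, w]))"
      by (intro sum.cong refl arg_cong[where f = "(*) _"] linear_real_eq_sum_axis[OF lin(2)])
    also have "\<dots> = (\<Sum>i\<in>UNIV. u $ i * (\<Sum>j\<in>UNIV. v $ j * (\<Sum>k\<in>UNIV. w $ k * \<eta> [?e i, ?e j, ?e k])))"
      by (intro sum.cong refl arg_cong[where f = "(*) _"] linear_real_eq_sum_axis[OF lin(3)])
    finally show ?thesis .
  qed
  show ?thesis
    unfolding coefficient3_def c_def[symmetric]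
    by (subst expand) (simp add: sum_3 z perm c_def[symmetric] det_3 matrix_def algebra_simps)
qed

section \<open>Differential forms on a manifold\<close>

lemma form_eq_0: "\<omega> \<in> forms M s k \<Longrightarrow> \<not> (\<kappa> \<in> atlas M \<and> x \<in> cimg \<kappa>) \<Longrightarrow> \<omega> \<kappa> x = (\<lambda>_. 0)"
  unfolding forms_def by blast

lemma form_alternating: "\<omega> \<in> forms M s k \<Longrightarrow> \<kappa> \<in> atlas M \<Longrightarrow> x \<in> cimg \<kappa> \<Longrightarrow> alternating k (\<omega> \<kappa> x)"
  unfolding forms_def by blast

lemma form_smooth: "\<omega> \<in> forms M s k \<Longrightarrow> \<kappa> \<in> atlas M \<Longrightarrow> smooth_on (cimg \<kappa>) (\<lambda>x. \<omega> \<kappa> x vs)"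
  unfolding forms_def by blast

lemma form_transform:
  "\<omega> \<in> forms M s k \<Longrightarrow> \<kappa> \<in> atlas M \<Longrightarrow> \<kappa>' \<in> atlas M \<Longrightarrow> p \<in> cdom \<kappa> \<Longrightarrow> p \<in> cdom \<kappa>' \<Longrightarrow>
    \<omega> \<kappa> (cmap \<kappa> p) vs = orient s (jacobian \<kappa> \<kappa>' (cmap \<kappa> p))
      * \<omega> \<kappa>' (cmap \<kappa>' p) (map (jacobian \<kappa> \<kappa>' (cmap \<kappa> p)) vs)"
  unfolding forms_def by blast

lemma forms_diff:
  assumes M: "smooth_manifold3 M" and \<omega>: "\<omega> \<in> forms M s k" and \<eta>: "\<eta> \<in> forms M s k"
  shows "(\<lambda>\<kappa> x vs. \<omega> \<kappa> x vs - \<eta> \<kappa> x vs) \<in> forms M s k"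
proof -
  have open_cimg: "open (cimg \<kappa>)" if "\<kappa> \<in> atlas M" for \<kappa>
    using M that by (simp add: smooth_manifold3_def)
  show ?thesis
    unfolding forms_def mem_Collect_eq
  proof (intro conjI ballI allI impI)
    fix \<kappa> assume "\<kappa> \<in> atlas M"
    then show "smooth_on (cimg \<kappa>) (\<lambda>x. \<omega> \<kappa> x vs - \<eta> \<kappa> x vs)" for vs
      by (intro smooth_on_diff open_cimg form_smooth[OF \<omega>] form_smooth[OF \<eta>])
    from \<open>\<kappa> \<in> atlas M\<close> show "alternating k (\<lambda>vs. \<omega> \<kappa> x vs - \<eta> \<kappa> x vs)" if "x \<in> cimg \<kappa>" for x
      using that
      by (intro alternating_diff form_alternating[OF \<omega>] form_alternating[OF \<eta>])
  next
    fix \<kappa> x assume "\<not> (\<kappa> \<in> atlas M \<and> x \<in> cimg \<kappa>)"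
    then show "(\<lambda>vs. \<omega> \<kappa> x vs - \<eta> \<kappa> x vs) = (\<lambda>_. 0)"
      by (simp add: form_eq_0[OF \<omega>] form_eq_0[OF \<eta>])
  next
    fix \<kappa> \<kappa>' p vs assume *: "\<kappa> \<in> atlas M" "\<kappa>' \<in> atlas M" "p \<in> cdom \<kappa> \<inter> cdom \<kappa>'"
    show "\<omega> \<kappa> (cmap \<kappa> p) vs - \<eta> \<kappa> (cmap \<kappa> p) vs = orient s (jacobian \<kappa> \<kappa>' (cmap \<kappa> p))
        * (\<omega> \<kappa>' (cmap \<kappa>' p) (map (jacobian \<kappa> \<kappa>' (cmap \<kappa> p)) vs)
          - \<eta> \<kappa>' (cmap \<kappa>' p) (map (jacobian \<kappa> \<kappa>' (cmap \<kappa> p)) vs))"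
      using * form_transform[OF \<omega>, of \<kappa> \<kappa>' p vs] form_transform[OF \<eta>, of \<kappa> \<kappa>' p vs]
      by (simp add: right_diff_distrib)
  qed
qed

section \<open>Charts, transition maps and their Jacobians\<close>

context
  fixes M :: "('a, 'z) manifold3_scheme"
  assumes M: "smooth_manifold3 M"
begin

lemma open_cimg: "\<kappa> \<in> atlas M \<Longrightarrow> open (cimg \<kappa>)"
  and openin_cdom: "\<kappa> \<in> atlas M \<Longrightarrow> openin (mtop M) (cdom \<kappa>)"
  and homeo_cmap: "\<kappa> \<in> atlas M \<Longrightarrow>
    homeomorphic_map (subtopology (mtop M) (cdom \<kappa>)) (top_of_set (cimg \<kappa>)) (cmap \<kappa>)"
  and smooth_transition: "\<kappa> \<in> atlas M \<Longrightarrow> \<kappa>' \<in> atlas M \<Longrightarrow>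
    smooth_on (cmap \<kappa> ` (cdom \<kappa> \<inter> cdom \<kappa>')) (transition \<kappa> \<kappa>')"
  using M by (simp_all add: smooth_manifold3_def)

lemma inj_cmap: "\<kappa> \<in> atlas M \<Longrightarrow> inj_on (cmap \<kappa>) (cdom \<kappa>)"
  using homeomorphic_imp_injective_map[OF homeo_cmap] openin_subset[OF openin_cdom]
  by (simp add: inf_absorb2)

lemma open_cmap_image:
  assumes \<kappa>: "\<kappa> \<in> atlas M" and U: "openin (mtop M) U"
  shows "open (cmap \<kappa> ` (cdom \<kappa> \<inter> U))"
proof -
  have "openin (subtopology (mtop M) (cdom \<kappa>)) (cdom \<kappa> \<inter> U)"
    using openin_cdom[OF \<kappa>] U by (simp add: openin_open_subtopology openin_Int)
  then have "openin (top_of_set (cimg \<kappa>)) (cmap \<kappa> ` (cdom \<kappa> \<inter> U))"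
    using homeomorphic_imp_open_map[OF homeo_cmap[OF \<kappa>]] unfolding open_map_def by blast
  then show ?thesis using open_cimg[OF \<kappa>] openin_open_trans by blast
qed

lemma transition_cmap:
  "\<kappa> \<in> atlas M \<Longrightarrow> p \<in> cdom \<kappa> \<Longrightarrow> transition \<kappa> \<kappa>' (cmap \<kappa> p) = cmap \<kappa>' p"
  by (simp add: transition_def inv_into_f_f[OF inj_cmap])

lemma transition_has_derivative:
  assumes "\<kappa> \<in> atlas M" "\<kappa>' \<in> atlas M" "x \<in> cmap \<kappa> ` (cdom \<kappa> \<inter> cdom \<kappa>')"
  shows "(transition \<kappa> \<kappa>' has_derivative jacobian \<kappa> \<kappa>' x) (at x)"
  using smooth_on_imp_differentiable[OF smooth_transition[OF assms(1,2)] assms(3)]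
  by (simp add: jacobian_def frechet_derivative_works)

lemma linear_jacobian:
  assumes "\<kappa> \<in> atlas M" "\<kappa>' \<in> atlas M" "x \<in> cmap \<kappa> ` (cdom \<kappa> \<inter> cdom \<kappa>')"
  shows "linear (jacobian \<kappa> \<kappa>' x)"
  using transition_has_derivative[OF assms] has_derivative_linear by blast

lemma jacobian_nth:
  assumes "\<kappa> \<in> atlas M" "\<kappa>' \<in> atlas M" "x \<in> cmap \<kappa> ` (cdom \<kappa> \<inter> cdom \<kappa>')"
  shows "jacobian \<kappa> \<kappa>' x v $ k = (\<Sum>i\<in>UNIV. v $ i * partial_deriv i (\<lambda>z. transition \<kappa> \<kappa>' z $ k) x)"
  using smooth_on_imp_differentiable[OF smooth_transition[OF assms(1,2)] assms(3)]
  by (simp add: jacobian_def frechet_derivative_eq_sum_partial_deriv partial_deriv_vec_nth)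

lemma open_overlap:
  "\<kappa> \<in> atlas M \<Longrightarrow> \<kappa>' \<in> atlas M \<Longrightarrow> open (cmap \<kappa> ` (cdom \<kappa> \<inter> cdom \<kappa>'))"
  by (rule open_cmap_image[OF _ openin_cdom])

text \<open>Passing to \<open>\<kappa>'\<close> and back is the identity on the whole open overlap,
  not merely at one point, so the chain rule gives the derivative of the identity.\<close>

lemma jacobian_inverse:
  assumes "\<kappa> \<in> atlas M" "\<kappa>' \<in> atlas M" "p \<in> cdom \<kappa>" "p \<in> cdom \<kappa>'"
  shows "jacobian \<kappa>' \<kappa> (cmap \<kappa>' p) \<circ> jacobian \<kappa> \<kappa>' (cmap \<kappa> p) = id"
proof -
  let ?S = "cmap \<kappa> ` (cdom \<kappa> \<inter> cdom \<kappa>')"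
  have x: "cmap \<kappa> p \<in> ?S" "cmap \<kappa>' p \<in> cmap \<kappa>' ` (cdom \<kappa>' \<inter> cdom \<kappa>)" using assms by auto
  have "(transition \<kappa>' \<kappa> has_derivative jacobian \<kappa>' \<kappa> (cmap \<kappa>' p)) (at (transition \<kappa> \<kappa>' (cmap \<kappa> p)))"
    using transition_has_derivative[OF assms(2,1) x(2)] assms by (simp add: transition_cmap)
  from diff_chain_at[OF transition_has_derivative[OF assms(1,2) x(1)] this]
  have D: "((transition \<kappa>' \<kappa> \<circ> transition \<kappa> \<kappa>') has_derivative
      (jacobian \<kappa>' \<kappa> (cmap \<kappa>' p) \<circ> jacobian \<kappa> \<kappa>' (cmap \<kappa> p))) (at (cmap \<kappa> p))" .
  have "(id has_derivative
      (jacobian \<kappa>' \<kappa> (cmap \<kappa>' p) \<circ> jacobian \<kappa> \<kappa>' (cmap \<kappa> p))) (at (cmap \<kappa> p))"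
    by (rule has_derivative_transform_within_open[OF D open_overlap[OF assms(1,2)] x(1)])
      (use assms in \<open>auto simp: transition_cmap\<close>)
  then show ?thesis by (rule has_derivative_unique[OF _ has_derivative_id])
qed

lemma det_jacobian_nonzero:
  assumes "\<kappa> \<in> atlas M" "\<kappa>' \<in> atlas M" "p \<in> cdom \<kappa>" "p \<in> cdom \<kappa>'"
  shows "det (matrix (jacobian \<kappa> \<kappa>' (cmap \<kappa> p))) \<noteq> 0"
proof -
  have "linear (jacobian \<kappa> \<kappa>' (cmap \<kappa> p))" "linear (jacobian \<kappa>' \<kappa> (cmap \<kappa>' p))"
    using assms by (auto intro!: linear_jacobian)
  then have "matrix (jacobian \<kappa>' \<kappa> (cmap \<kappa>' p)) ** matrix (jacobian \<kappa> \<kappa>' (cmap \<kappa> p)) = mat 1"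
    using jacobian_inverse[OF assms] by (simp add: matrix_compose[symmetric] matrix_id_mat_1)
  then have "det (matrix (jacobian \<kappa>' \<kappa> (cmap \<kappa>' p))) * det (matrix (jacobian \<kappa> \<kappa>' (cmap \<kappa> p))) = 1"
    by (metis det_mul det_I)
  then show ?thesis by auto
qed

lemma continuous_det_jacobian:
  assumes \<kappa>: "\<kappa> \<in> atlas M" "\<kappa>' \<in> atlas M"
  shows "continuous_on (cmap \<kappa> ` (cdom \<kappa> \<inter> cdom \<kappa>')) (\<lambda>x. det (matrix (jacobian \<kappa> \<kappa>' x)))"
proof -
  let ?S = "cmap \<kappa> ` (cdom \<kappa> \<inter> cdom \<kappa>')"
  note sm = smooth_on_partial_deriv[OF smooth_on_vec_nth[OF open_overlap[OF \<kappa>] smooth_transition[OF \<kappa>]]]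
  have "continuous_on ?S (\<lambda>x. partial_deriv j (\<lambda>z. transition \<kappa> \<kappa>' z $ k) x)" for j k
    using smooth_on_imp_differentiable[OF sm]
    by (intro continuous_at_imp_continuous_on ballI differentiable_imp_continuous_within)
  moreover have "matrix (jacobian \<kappa> \<kappa>' x) $ k $ j = partial_deriv j (\<lambda>z. transition \<kappa> \<kappa>' z $ k) x"
    if "x \<in> ?S" for x k j
    by (simp add: matrix_def jacobian_nth[OF \<kappa> that] axis_def if_distrib[of "\<lambda>a. a * _"] cong: if_cong)
  ultimately show ?thesis
    unfolding det_3 by (auto intro!: continuous_intros cong: continuous_on_cong)
qed

text \<open>A continuous nonvanishing function keeps its sign near a point. Positivity of the
  product with the value at \<open>p\<close> expresses equal signs without separating cases. A
  neighbourhood is wanted because the transformation law will be differentiated.\<close>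

lemma orient_locally_constant:
  assumes "\<kappa> \<in> atlas M" "\<kappa>' \<in> atlas M" "p \<in> cdom \<kappa>" "p \<in> cdom \<kappa>'"
  obtains N where "open N" "cmap \<kappa> p \<in> N" "N \<subseteq> cmap \<kappa> ` (cdom \<kappa> \<inter> cdom \<kappa>')"
    "\<And>y. y \<in> N \<Longrightarrow> orient s (jacobian \<kappa> \<kappa>' y) = orient s (jacobian \<kappa> \<kappa>' (cmap \<kappa> p))"
proof -
  let ?S = "cmap \<kappa> ` (cdom \<kappa> \<inter> cdom \<kappa>')"
  let ?d = "\<lambda>x. det (matrix (jacobian \<kappa> \<kappa>' x))"
  have x: "cmap \<kappa> p \<in> ?S" using assms by auto
  have cont: "continuous_on ?S (\<lambda>x. ?d x * ?d (cmap \<kappa> p))"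
    by (intro continuous_intros continuous_det_jacobian assms)
  let ?N = "?S \<inter> (\<lambda>x. ?d x * ?d (cmap \<kappa> p)) -` {0<..}"
  have "open ?N"
    by (rule continuous_open_preimage[OF cont open_overlap]) (use assms in auto)
  moreover have "cmap \<kappa> p \<in> ?N"
    using x det_jacobian_nonzero[OF assms] by (simp add: zero_less_mult_iff) linarith
  moreover have "orient s (jacobian \<kappa> \<kappa>' y) = orient s (jacobian \<kappa> \<kappa>' (cmap \<kappa> p))" if "y \<in> ?N" for y
    using that by (auto simp: orient_def zero_less_mult_iff split: parity.split)
  ultimately show ?thesis using that[of ?N] by blast
qed

section \<open>The exterior derivative of a 1-form and its wedge with another 1-form\<close>

lemma ext_deriv_1:
  assumes "\<kappa> \<in> atlas M" "x \<in> cimg \<kappa>"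
  shows "ext_deriv M \<omega> \<kappa> x [u, v] =
    frechet_derivative (\<lambda>y. \<omega> \<kappa> y [v]) (at x) u - frechet_derivative (\<lambda>y. \<omega> \<kappa> y [u]) (at x) v"
  using assms by (simp add: ext_deriv_def local_form_def lessThan_Suc)

text \<open>Differentiating the transformation law of a 1-form produces the second derivatives of the
  transition map, which are symmetric and cancel in the alternating sum.\<close>
lemma ext_deriv_transform:
  assumes \<omega>: "\<omega> \<in> forms M s 1"
    and \<kappa>: "\<kappa> \<in> atlas M" "\<kappa>' \<in> atlas M" and p: "p \<in> cdom \<kappa>" "p \<in> cdom \<kappa>'"
  shows "ext_deriv M \<omega> \<kappa> (cmap \<kappa> p) [u, v] =
    orient s (jacobian \<kappa> \<kappa>' (cmap \<kappa> p)) *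
      ext_deriv M \<omega> \<kappa>' (cmap \<kappa>' p) [jacobian \<kappa> \<kappa>' (cmap \<kappa> p) u, jacobian \<kappa> \<kappa>' (cmap \<kappa> p) v]"
proof -
  define S where "S = cmap \<kappa> ` (cdom \<kappa> \<inter> cdom \<kappa>')"
  define T where "T = transition \<kappa> \<kappa>'"
  define x where "x = cmap \<kappa> p"
  define J where "J = jacobian \<kappa> \<kappa>' x"
  define c where "c = orient s J"
  define b where "b k z = \<omega> \<kappa>' z [axis k 1]" for k z
  define t where "t k z = T z $ k" for k z
  have S: "open S" "x \<in> S" using open_overlap[OF \<kappa>] p by (auto simp: S_def x_def)
  have Tx: "T x = cmap \<kappa>' p" using \<kappa>(1) p(1) by (simp add: T_def x_def transition_cmap)
  have t: "smooth_on S (t k)" for k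
    unfolding t_def S_def T_def using smooth_on_vec_nth open_overlap smooth_transition \<kappa> by blast
  have J_nth: "jacobian \<kappa> \<kappa>' y w $ k = (\<Sum>i\<in>UNIV. w $ i * partial_deriv i (t k) y)" if "y \<in> S" for y w k
    using that jacobian_nth[OF \<kappa>] unfolding S_def t_def T_def by blast
  have T_der: "(T has_derivative J) (at x)"
    using transition_has_derivative[OF \<kappa>] S(2) by (simp add: S_def T_def J_def)
  have b_diff: "b k differentiable (at (T x))" for k
    unfolding Tx b_def using smooth_on_imp_differentiable[OF form_smooth[OF \<omega> \<kappa>(2)]] p(2) by blast
  define db where "db k = frechet_derivative (b k) (at (T x))" for k
  have bT_der: "((\<lambda>y. b k (T y)) has_derivative (\<lambda>h. db k (J h))) (at x)" for k
    using diff_chain_at[OF T_der b_diff[unfolded frechet_derivative_works]] by (simp add: o_def db_def)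
  define ddt where "ddt i k = frechet_derivative (partial_deriv i (t k)) (at x)" for i k
  have dt_diff: "partial_deriv i (t k) differentiable (at x)" for i k
    by (rule smooth_on_imp_differentiable[OF smooth_on_partial_deriv[OF t] S(2)])
  then have dt_der: "(partial_deriv i (t k) has_derivative ddt i k) (at x)" for i k
    by (simp add: ddt_def frechet_derivative_works)
  have ddt: "ddt i k w = (\<Sum>j\<in>UNIV. w $ j * partial_deriv j (partial_deriv i (t k)) x)" for i k w
    unfolding ddt_def using frechet_derivative_eq_sum_partial_deriv[OF dt_diff] by simp
  \<comment> \<open>By the product rule \<open>Q\<close> collects the second derivatives of the
    transition map and \<open>P\<close> the derivatives of the components of
    \<open>\<omega>\<close>.\<close>
  define Q where "Q w1 w2 = (\<Sum>k\<in>UNIV. (\<Sum>i\<in>UNIV. w2 $ i * ddt i k w1) * b k (T x))" for w1 w2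
  define P where "P w1 w2 = (\<Sum>k\<in>UNIV. J w2 $ k * db k (J w1))" for w1 w2
  have Q_sym: "Q w1 w2 = Q w2 w1" for w1 w2
  proof -
    have "(\<Sum>i\<in>UNIV. w2 $ i * ddt i k w1) = (\<Sum>i\<in>UNIV. w1 $ i * ddt i k w2)" for k
      unfolding ddt sum_distrib_left
      by (subst sum.swap) (simp add: partial_deriv_commute[OF S(1) t S(2), of _ _ k] mult.left_commute)
    then show ?thesis by (simp add: Q_def)
  qed
  obtain N where N: "open N" "x \<in> N" "N \<subseteq> S" "\<And>y. y \<in> N \<Longrightarrow> orient s (jacobian \<kappa> \<kappa>' y) = c"
    using orient_locally_constant[OF \<kappa> p, of s] unfolding S_def x_def c_def J_def by metis
  have lhs: "frechet_derivative (\<lambda>y. \<omega> \<kappa> y [w2]) (at x) w1 = c * (Q w1 w2 + P w1 w2)" for w1 w2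
  proof -
    \<comment> \<open>The identity is about to be differentiated, so it must hold throughout
      \<open>N\<close>, where the orientation factor has the constant value
      \<open>c\<close>.\<close>
    have eq: "\<omega> \<kappa> y [w2] = c * (\<Sum>k\<in>UNIV. (\<Sum>i\<in>UNIV. w2 $ i * partial_deriv i (t k) y) * b k (T y))"
      if y: "y \<in> N" for y
    proof -
      obtain q where q: "q \<in> cdom \<kappa>" "q \<in> cdom \<kappa>'" "y = cmap \<kappa> q" using y N(3) by (auto simp: S_def)
      have "\<omega> \<kappa> y [w2] = c * \<omega> \<kappa>' (T y) [jacobian \<kappa> \<kappa>' y w2]"
        using form_transform[OF \<omega> \<kappa> q(1,2), of "[w2]"] N(4)[OF y] q \<kappa>
        by (simp add: T_def transition_cmap)
      also have "\<omega> \<kappa>' (T y) [jacobian \<kappa> \<kappa>' y w2] = (\<Sum>k\<in>UNIV. jacobian \<kappa> \<kappa>' y w2 $ k * b k (T y))"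
        unfolding b_def
        by (rule alternating_1_eq_sum[OF form_alternating[OF \<omega> \<kappa>(2)]])
          (use q \<kappa> in \<open>auto simp: T_def transition_cmap\<close>)
      finally show ?thesis using J_nth y N(3) by (simp add: subset_iff)
    qed
    have der: "((\<lambda>y. c * (\<Sum>k\<in>UNIV. (\<Sum>i\<in>UNIV. w2 $ i * partial_deriv i (t k) y) * b k (T y)))
        has_derivative (\<lambda>h. c * (Q h w2 + P h w2))) (at x)"
      unfolding Q_def P_def J_nth[OF S(2), folded J_def] sum.distrib[symmetric]
      by (rule derivative_eq_intros dt_der bT_der refl)+
        (simp add: add.commute)
    have "((\<lambda>y. \<omega> \<kappa> y [w2]) has_derivative (\<lambda>h. c * (Q h w2 + P h w2))) (at x)"
      by (rule has_derivative_transform_within_open[OF der N(1,2)]) (simp add: eq)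
    then show ?thesis by (simp add: frechet_derivative_at[symmetric])
  qed
  \<comment> \<open>Here the vector \<open>J w2\<close> is held fixed while the base point moves, so
    no second derivatives of the transition map arise.\<close>
  have rhs: "frechet_derivative (\<lambda>y. \<omega> \<kappa>' y [J w2]) (at (T x)) (J w1) = P w1 w2" for w1 w2
  proof -
    have der: "((\<lambda>y. \<Sum>k\<in>UNIV. J w2 $ k * b k y) has_derivative (\<lambda>h. \<Sum>k\<in>UNIV. J w2 $ k * db k h)) (at (T x))"
      using b_diff unfolding frechet_derivative_works db_def[symmetric]
      by (auto intro!: derivative_eq_intros)
    have "((\<lambda>y. \<omega> \<kappa>' y [J w2]) has_derivative (\<lambda>h. \<Sum>k\<in>UNIV. J w2 $ k * db k h)) (at (T x))"
    proof (rule has_derivative_transform_within_open[OF der open_cimg[OF \<kappa>(2)]])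
      show "T x \<in> cimg \<kappa>'" using Tx p by simp
      show "(\<Sum>k\<in>UNIV. J w2 $ k * b k y) = \<omega> \<kappa>' y [J w2]" if "y \<in> cimg \<kappa>'" for y
        using alternating_1_eq_sum[OF form_alternating[OF \<omega> \<kappa>(2) that], of "J w2"] by (simp add: b_def)
    qed
    then show ?thesis by (simp add: frechet_derivative_at[symmetric] P_def)
  qed
  have "x \<in> cimg \<kappa>" "T x \<in> cimg \<kappa>'" using p Tx by (auto simp: x_def)
  then have "ext_deriv M \<omega> \<kappa> x [u, v] = c * ext_deriv M \<omega> \<kappa>' (T x) [J u, J v]"
    using Q_sym[of u v] by (simp add: ext_deriv_1 \<kappa> lhs rhs algebra_simps)
  then show ?thesis by (simp add: x_def[symmetric] Tx[symmetric] J_def[symmetric] c_def[symmetric])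
qed

lemma ext_deriv_swap:
  "\<kappa> \<in> atlas M \<Longrightarrow> x \<in> cimg \<kappa> \<Longrightarrow> ext_deriv M \<omega> \<kappa> x [v, u] = - ext_deriv M \<omega> \<kappa> x [u, v]"
  by (simp add: ext_deriv_1)

text \<open>Additivity and homogeneity of \<open>\<omega>\<close> in its vector hold at all points
  of the open chart image, so both identities can be differentiated in the point.\<close>

lemma linear_frechet_derivative_form:
  assumes \<omega>: "\<omega> \<in> forms M s 1" and \<kappa>: "\<kappa> \<in> atlas M" "x \<in> cimg \<kappa>"
  shows "linear (\<lambda>v. frechet_derivative (\<lambda>y. \<omega> \<kappa> y [v]) (at x) u)"
proof (rule linearI)
  have lin: "linear (\<lambda>v. \<omega> \<kappa> y [v])" if "y \<in> cimg \<kappa>" for y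
    using alternating_linear[OF form_alternating[OF \<omega> \<kappa>(1) that], of "[0]" 0] by simp
  have der: "((\<lambda>y. \<omega> \<kappa> y [v]) has_derivative frechet_derivative (\<lambda>y. \<omega> \<kappa> y [v]) (at x)) (at x)" for v
    using smooth_on_imp_differentiable[OF form_smooth[OF \<omega> \<kappa>(1)] \<kappa>(2)]
    by (simp add: frechet_derivative_works)
  fix v w and r :: real
  have "((\<lambda>y. \<omega> \<kappa> y [v + w]) has_derivative (\<lambda>u. frechet_derivative (\<lambda>y. \<omega> \<kappa> y [v]) (at x) u
      + frechet_derivative (\<lambda>y. \<omega> \<kappa> y [w]) (at x) u)) (at x)"
    by (rule has_derivative_transform_within_open[OF has_derivative_add[OF der der] open_cimg[OF \<kappa>(1)] \<kappa>(2)])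
      (simp add: linear_add[OF lin])
  then show "frechet_derivative (\<lambda>y. \<omega> \<kappa> y [v + w]) (at x) u =
      frechet_derivative (\<lambda>y. \<omega> \<kappa> y [v]) (at x) u + frechet_derivative (\<lambda>y. \<omega> \<kappa> y [w]) (at x) u"
    by (rule frechet_derivative_at[symmetric, THEN fun_cong])
  have "((\<lambda>y. \<omega> \<kappa> y [r *\<^sub>R v]) has_derivative
      (\<lambda>u. r *\<^sub>R frechet_derivative (\<lambda>y. \<omega> \<kappa> y [v]) (at x) u)) (at x)"
    by (rule has_derivative_transform_within_open[OF has_derivative_scaleR_right[OF der] open_cimg[OF \<kappa>(1)] \<kappa>(2)])
      (simp add: linear_cmul[OF lin])
  then show "frechet_derivative (\<lambda>y. \<omega> \<kappa> y [r *\<^sub>R v]) (at x) u =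
      r *\<^sub>R frechet_derivative (\<lambda>y. \<omega> \<kappa> y [v]) (at x) u"
    by (rule frechet_derivative_at[symmetric, THEN fun_cong])
qed

text \<open>Only one factor is twisted: \<open>\<alpha>\<close> transforms without a sign, so the
  product inherits exactly the orientation factor of \<open>ext_deriv M \<beta>\<close>.\<close>

lemma wedge_ext_deriv_forms:
  assumes \<alpha>: "\<alpha> \<in> forms M Straight 1" and \<beta>: "\<beta> \<in> forms M Twisted 1"
  shows "wedge_form 1 2 \<alpha> (ext_deriv M \<beta>) \<in> forms M Twisted 3"
proof -
  let ?w = "wedge_form 1 2 \<alpha> (ext_deriv M \<beta>)" and ?d = "ext_deriv M \<beta>"
  have eq: "?w \<kappa> x [u, v, w] = \<alpha> \<kappa> x [u] * ?d \<kappa> x [v, w] - \<alpha> \<kappa> x [v] * ?d \<kappa> x [u, w] + \<alpha> \<kappa> x [w] * ?d \<kappa> x [u, v]"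
    if "\<kappa> \<in> atlas M" "x \<in> cimg \<kappa>" for \<kappa> x u v w
    unfolding wedge_form_def using that by (intro wedge_1_2 ext_deriv_swap)
  have len: "?w \<kappa> x vs = 0" if "length vs \<noteq> 3" for \<kappa> x vs
    using that by (simp add: wedge_form_def wedge_def)
  have \<beta>_diff: "(\<lambda>y. \<beta> \<kappa> y vs) differentiable (at x)" if "\<kappa> \<in> atlas M" "x \<in> cimg \<kappa>" for \<kappa> x vs
    using smooth_on_imp_differentiable[OF form_smooth[OF \<beta>]] that by blast
  have "?w \<kappa> x = (\<lambda>_. 0)" if "\<not> (\<kappa> \<in> atlas M \<and> x \<in> cimg \<kappa>)" for \<kappa> x
    using form_eq_0[OF \<alpha> that] by (auto simp: wedge_form_def wedge_def)
  moreover have "alternating 3 (?w \<kappa> x)" if \<kappa>: "\<kappa> \<in> atlas M" "x \<in> cimg \<kappa>" for \<kappa> x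
  proof -
    have lin\<alpha>: "linear (\<lambda>v. \<alpha> \<kappa> x [v])"
      using alternating_linear[OF form_alternating[OF \<alpha> \<kappa>], of "[0]" 0] by simp
    have "linear (\<lambda>v. frechet_derivative (\<lambda>y. \<beta> \<kappa> y [v]) (at x) u)" for u
      by (rule linear_frechet_derivative_form[OF \<beta> \<kappa>])
    moreover have "linear (\<lambda>u. frechet_derivative (\<lambda>y. \<beta> \<kappa> y [v]) (at x) u)" for v
      by (rule linear_frechet_derivative[OF \<beta>_diff[OF \<kappa>]])
    ultimately have "linear (\<lambda>u. ?d \<kappa> x [u, v])" "linear (\<lambda>u. ?d \<kappa> x [v, u])" for v
      unfolding ext_deriv_1[OF \<kappa>] by (intro linear_compose_sub; simp)+
    note lin = lin\<alpha> this
    have "linear (\<lambda>z. ?w \<kappa> x [z, v, w])" "linear (\<lambda>z. ?w \<kappa> x [u, z, w])" "linear (\<lambda>z. ?w \<kappa> x [u, v, z])" for u v w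
      unfolding eq[OF \<kappa>]
      by (auto intro!: linearI simp: linear_add[OF lin(1)] linear_add[OF lin(2)] linear_add[OF lin(3)]
        linear_cmul[OF lin(1)] linear_cmul[OF lin(2)] linear_cmul[OF lin(3)] algebra_simps)
    moreover have "?w \<kappa> x [u, u, w] = 0" "?w \<kappa> x [u, w, u] = 0" "?w \<kappa> x [w, u, u] = 0" for u w
      unfolding eq[OF \<kappa>]
      using ext_deriv_swap[OF \<kappa>, of \<beta> u u] ext_deriv_swap[OF \<kappa>, of \<beta> u w] by simp_all
    ultimately show ?thesis using len by (intro alternating_3I) blast+
  qed
  moreover have "smooth_on (cimg \<kappa>) (\<lambda>x. ?w \<kappa> x vs)" if \<kappa>: "\<kappa> \<in> atlas M" for \<kappa> vs
  proof (cases "length vs = 3")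
    case True
    then obtain u v w where vs: "vs = [u, v, w]" using length_3_cases by blast
    \<comment> \<open>Smoothness is closed under \<open>partial_deriv\<close>, so the directional
      derivatives in \<open>ext_deriv\<close> are expanded in partial derivatives.\<close>
    have "smooth_on (cimg \<kappa>) (\<lambda>x. ?d \<kappa> x [u, v])" for u v
    proof (rule smooth_on_cong[OF open_cimg[OF \<kappa>]])
      show "smooth_on (cimg \<kappa>) (\<lambda>x. (\<Sum>i\<in>UNIV. u $ i * partial_deriv i (\<lambda>y. \<beta> \<kappa> y [v]) x)
          - (\<Sum>i\<in>UNIV. v $ i * partial_deriv i (\<lambda>y. \<beta> \<kappa> y [u]) x))"
        by (intro smooth_on_diff smooth_on_sum smooth_on_mult smooth_on_const smooth_on_partial_deriv
          form_smooth[OF \<beta> \<kappa>] open_cimg[OF \<kappa>])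
      show "(\<Sum>i\<in>UNIV. u $ i * partial_deriv i (\<lambda>y. \<beta> \<kappa> y [v]) x)
          - (\<Sum>i\<in>UNIV. v $ i * partial_deriv i (\<lambda>y. \<beta> \<kappa> y [u]) x) = ?d \<kappa> x [u, v]" if "x \<in> cimg \<kappa>" for x
        using \<beta>_diff[OF \<kappa> that] by (simp add: ext_deriv_1 \<kappa> that frechet_derivative_eq_sum_partial_deriv)
    qed
    note d = this
    show ?thesis unfolding vs
      by (rule smooth_on_cong[OF open_cimg[OF \<kappa>] _ eq[OF \<kappa>, symmetric]])
        (intro smooth_on_add smooth_on_diff smooth_on_mult d form_smooth[OF \<alpha> \<kappa>] open_cimg[OF \<kappa>])
  next
    case False
    then show ?thesis using smooth_on_const[OF open_cimg[OF \<kappa>], of 0] by (simp only: len[OF False])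
  qed
  moreover have "?w \<kappa> (cmap \<kappa> p) vs = orient Twisted (jacobian \<kappa> \<kappa>' (cmap \<kappa> p))
      * ?w \<kappa>' (cmap \<kappa>' p) (map (jacobian \<kappa> \<kappa>' (cmap \<kappa> p)) vs)"
    if \<kappa>: "\<kappa> \<in> atlas M" "\<kappa>' \<in> atlas M" and p: "p \<in> cdom \<kappa>" "p \<in> cdom \<kappa>'" for \<kappa> \<kappa>' p vs
  proof (cases "length vs = 3")
    case True
    then obtain u v w where vs: "vs = [u, v, w]" using length_3_cases by blast
    show ?thesis
      using p form_transform[OF \<alpha> \<kappa> p]
      by (simp add: vs eq[unfolded One_nat_def] \<kappa> ext_deriv_transform[OF \<beta> \<kappa> p] orient_def algebra_simps)
  qed (simp add: len[unfolded One_nat_def])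
  ultimately show ?thesis unfolding forms_def by blast
qed

end

section \<open>Integration\<close>

text \<open>The change of variables theorem concerns vector-valued integrands; a real integrand is
  carried to \<open>real^1\<close> by \<open>vec\<close> and back.\<close>

lemma absolutely_integrable_change_of_variables_real:
  fixes f g :: "real^'n::{finite,wellorder} \<Rightarrow> real" and T :: "real^'n::_ \<Rightarrow> real^'n::_"
  assumes S: "S \<in> sets lebesgue"
    and der: "\<And>x. x \<in> S \<Longrightarrow> (T has_derivative T' x) (at x within S)"
    and inj: "inj_on T S"
    and fg: "\<And>x. x \<in> S \<Longrightarrow> f x = \<bar>det (matrix (T' x))\<bar> * g (T x)"
  shows "f absolutely_integrable_on S \<and> integral S f = b \<longleftrightarrow>
    g absolutely_integrable_on (T ` S) \<and> integral (T ` S) g = b"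
proof -
  have "(\<lambda>x. \<bar>det (matrix (T' x))\<bar> *\<^sub>R (vec (g (T x)) :: real^1)) absolutely_integrable_on S \<and>
      integral S (\<lambda>x. \<bar>det (matrix (T' x))\<bar> *\<^sub>R (vec (g (T x)) :: real^1)) = vec b \<longleftrightarrow>
    (\<lambda>y. vec (g y) :: real^1) absolutely_integrable_on (T ` S) \<and>
      integral (T ` S) (\<lambda>y. vec (g y) :: real^1) = vec b"
    by (rule has_absolute_integral_change_of_variables[OF S der inj])
  then have *: "(\<lambda>x. \<bar>det (matrix (T' x))\<bar> * g (T x)) absolutely_integrable_on S \<and>
      integral S (\<lambda>x. \<bar>det (matrix (T' x))\<bar> * g (T x)) = b \<longleftrightarrow>
    g absolutely_integrable_on (T ` S) \<and> integral (T ` S) g = b"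
    by (simp add: absolutely_integrable_on_1_iff integral_on_1_eq o_def vec_eq_iff)
  have "f absolutely_integrable_on S \<longleftrightarrow> (\<lambda>x. \<bar>det (matrix (T' x))\<bar> * g (T x)) absolutely_integrable_on S"
    by (rule set_integrable_cong) (auto simp: fg)
  moreover have "integral S f = integral S (\<lambda>x. \<bar>det (matrix (T' x))\<bar> * g (T x))"
    by (rule integral_cong) (rule fg)
  ultimately show ?thesis using * by simp
qed

lemma set_integral_change_of_variables_real:
  fixes f g :: "real^'n::{finite,wellorder} \<Rightarrow> real" and T :: "real^'n::_ \<Rightarrow> real^'n::_"
  assumes S: "S \<in> sets lebesgue"
    and der: "\<And>x. x \<in> S \<Longrightarrow> (T has_derivative T' x) (at x within S)"
    and inj: "inj_on T S"
    and fg: "\<And>x. x \<in> S \<Longrightarrow> f x = \<bar>det (matrix (T' x))\<bar> * g (T x)"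
    and g: "set_integrable lebesgue (T ` S) g"
  shows "set_integrable lebesgue S f" "(LINT x:S|lebesgue. f x) = (LINT y:T ` S|lebesgue. g y)"
  \<comment> \<open>With \<open>b\<close> the integral over the image, the equivalence turns into an
    equality of integrals.\<close>
  using absolutely_integrable_change_of_variables_real[OF S der inj fg, where b = "integral (T ` S) g"] g
  by (auto simp: set_lebesgue_integral_eq_integral)

text \<open>At each point at most one summand is nonzero, so the series of functions converges
  absolutely everywhere. Summability of the integrals of absolute values then allows sum and
  integral to be exchanged.\<close>

lemma
  fixes f :: "'a \<Rightarrow> real"
  assumes disj: "\<And>i j::nat. i \<noteq> j \<Longrightarrow> A i \<inter> A j = {}"
    and f: "\<And>i. set_integrable M (A i) f"
    and summable: "summable (\<lambda>i. LINT x:A i|M. \<bar>f x\<bar>)"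
  shows set_integrable_disjoint_UN: "set_integrable M (\<Union>i. A i) f"
    and set_integral_disjoint_UN: "(LINT x:(\<Union>i. A i)|M. f x) = (\<Sum>i. LINT x:A i|M. f x)"
proof -
  have sums: "(\<lambda>i. indicator (A i) x *\<^sub>R f x) sums (indicator (\<Union>i. A i) x *\<^sub>R f x)" for x
    by (intro sums_scaleR_left indicator_sums disj)
  have f': "integrable M (\<lambda>x. indicator (A i) x *\<^sub>R f x)" for i
    using f by (simp add: set_integrable_def)
  have AE: "AE x in M. summable (\<lambda>i. norm (indicator (A i) x *\<^sub>R f x))"
    using disj by (intro AE_I2) (auto simp: abs_mult intro!: summable_mult2 sums_summable[OF indicator_sums])
  have "summable (\<lambda>i. LINT x|M. norm (indicator (A i) x *\<^sub>R f x))"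
    using summable by (simp add: set_lebesgue_integral_def abs_mult)
  note * = integrable_suminf[OF f' AE this] integral_suminf[OF f' AE this]
  show "set_integrable M (\<Union>i. A i) f"
    using *(1) by (simp only: set_integrable_def sums_unique[OF sums, symmetric])
  show "(LINT x:(\<Union>i. A i)|M. f x) = (\<Sum>i. LINT x:A i|M. f x)"
    using *(2) by (simp only: set_lebesgue_integral_def sums_unique[OF sums, symmetric])
qed

section \<open>Linearity of the integral, in a chart and over the manifold\<close>

lemma chart_integral_abs:
  "chart_integral \<kappa> A (\<lambda>\<kappa> x vs. \<bar>\<omega> \<kappa> x vs\<bar>) = (LINT x:cmap \<kappa> ` A|lebesgue. \<bar>coefficient3 (\<omega> \<kappa> x)\<bar>)"
  by (simp add: chart_integral_def coefficient3_def)

lemma abs_chart_integral_le: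
  "chart_integrable \<kappa> A \<omega> \<Longrightarrow> \<bar>chart_integral \<kappa> A \<omega>\<bar> \<le> chart_integral \<kappa> A (\<lambda>\<kappa> x vs. \<bar>\<omega> \<kappa> x vs\<bar>)"
  unfolding chart_integrable_def chart_integral_abs
  using set_integral_norm_bound[of lebesgue _ "\<lambda>x. coefficient3 (\<omega> \<kappa> x)"]
  by (simp add: chart_integral_def)

lemma chart_integral_diff:
  assumes "chart_integrable \<kappa> A \<omega>" "chart_integrable \<kappa> A \<eta>"
  shows "chart_integrable \<kappa> A (\<lambda>\<kappa> x vs. \<omega> \<kappa> x vs - \<eta> \<kappa> x vs)"
    and "chart_integral \<kappa> A (\<lambda>\<kappa> x vs. \<omega> \<kappa> x vs - \<eta> \<kappa> x vs) = chart_integral \<kappa> A \<omega> - chart_integral \<kappa> A \<eta>"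
  using assms by (simp_all add: chart_integrable_def chart_integral_def coefficient3_def)

text \<open>\<open>form_integral\<close> is a \<open>suminf\<close>, meaningful only for a
  convergent series; the absolute integrals in \<open>form_integrable\<close> give convergence by
  comparison.\<close>

lemma form_integral_sums:
  assumes "form_integrable M A \<omega>"
  shows "(\<lambda>n. chart_integral (chart_cover M n) (A \<inter> piece M n) \<omega>) sums form_integral M A \<omega>"
proof -
  have "summable (\<lambda>n. chart_integral (chart_cover M n) (A \<inter> piece M n) \<omega>)"
    using assms unfolding form_integrable_def
    by - (rule summable_comparison_test'[where N = 0], auto intro: abs_chart_integral_le)
  then show ?thesis by (simp add: form_integral_def summable_sums)
qed

text \<open>All estimates are made piece by piece in fixed charts, so the result covers arbitrary
  families of coordinate expressions and any value of \<open>chart_cover\<close>.\<close>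

lemma form_integral_diff:
  assumes \<omega>: "form_integrable M A \<omega>" and \<eta>: "form_integrable M A \<eta>"
  shows "form_integrable M A (\<lambda>\<kappa> x vs. \<omega> \<kappa> x vs - \<eta> \<kappa> x vs)"
    and "form_integral M A (\<lambda>\<kappa> x vs. \<omega> \<kappa> x vs - \<eta> \<kappa> x vs) = form_integral M A \<omega> - form_integral M A \<eta>"
proof -
  let ?\<theta> = "\<lambda>\<kappa> x vs. \<omega> \<kappa> x vs - \<eta> \<kappa> x vs"
  let ?I = "\<lambda>\<omega> n. chart_integral (chart_cover M n) (A \<inter> piece M n) \<omega>"
  let ?abs = "\<lambda>\<omega> \<kappa> x vs. \<bar>\<omega> \<kappa> x vs\<bar>"
  have int: "chart_integrable (chart_cover M n) (A \<inter> piece M n) \<omega>"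
    "chart_integrable (chart_cover M n) (A \<inter> piece M n) \<eta>" for n
    using \<omega> \<eta> by (simp_all add: form_integrable_def)
  note int_\<theta> = chart_integral_diff[OF int]
  have nonneg: "0 \<le> ?I (?abs ?\<theta>) n" for n
    using order_trans[OF abs_ge_zero abs_chart_integral_le[OF int_\<theta>(1)]] .
  have le: "?I (?abs ?\<theta>) n \<le> ?I (?abs \<omega>) n + ?I (?abs \<eta>) n" for n
  proof -
    let ?E = "cmap (chart_cover M n) ` (A \<inter> piece M n)"
    let ?f = "\<lambda>\<omega> x. \<bar>coefficient3 (\<omega> (chart_cover M n) x)\<bar>"
    have abs: "set_integrable lebesgue ?E (?f \<omega>)" "set_integrable lebesgue ?E (?f \<eta>)" "set_integrable lebesgue ?E (?f ?\<theta>)"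
      using int int_\<theta>(1) unfolding chart_integrable_def by (auto intro: set_integrable_abs)
    have "(LINT x:?E|lebesgue. ?f ?\<theta> x) \<le> (LINT x:?E|lebesgue. ?f \<omega> x + ?f \<eta> x)"
      by (rule set_integral_mono[OF abs(3) set_integral_add(1)[OF abs(1,2)]])
        (simp add: coefficient3_def abs_triangle_ineq4)
    then show ?thesis using abs by (simp add: chart_integral_abs set_integral_add)
  qed
  have "summable (\<lambda>n. ?I (?abs \<omega>) n + ?I (?abs \<eta>) n)"
    using \<omega> \<eta> by (auto simp: form_integrable_def intro: summable_add)
  then have "summable (?I (?abs ?\<theta>))"
    by (rule summable_comparison_test'[where N = 0]) (use nonneg le in auto)
  then show int': "form_integrable M A ?\<theta>"
    using int_\<theta>(1) by (simp add: form_integrable_def)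
  have "?I ?\<theta> sums (form_integral M A \<omega> - form_integral M A \<eta>)"
    unfolding int_\<theta>(2) by (intro sums_diff form_integral_sums \<omega> \<eta>)
  then show "form_integral M A ?\<theta> = form_integral M A \<omega> - form_integral M A \<eta>"
    using form_integral_sums[OF int'] sums_unique2 by blast
qed

section \<open>Evaluating the integral of a twisted 3-form in a given chart\<close>

context
  fixes M :: "('a, 'z) manifold3_scheme"
  assumes M: "smooth_manifold3 M"
begin

text \<open>\<open>chart_cover\<close> is a choice, so a sequence with its property must be
  exhibited. Second countability yields the Lindelof property, hence a countable subcover by chart
  domains.\<close>

lemma chart_cover_exhausts:
  assumes "\<kappa> \<in> atlas M"
  shows "chart_cover M n \<in> atlas M" "(\<Union>n. cdom (chart_cover M n)) = topspace (mtop M)"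
proof -
  have "Lindelof_space (mtop M)"
    using M by (intro second_countable_imp_Lindelof_space) (simp add: smooth_manifold3_def)
  moreover have "\<Union>(cdom ` atlas M) = topspace (mtop M)" "\<forall>U\<in>cdom ` atlas M. openin (mtop M) U"
    using M by (auto simp: smooth_manifold3_def)
  ultimately obtain \<V> where "countable \<V>" "\<V> \<subseteq> cdom ` atlas M" "\<Union>\<V> = topspace (mtop M)"
    unfolding Lindelof_space_def by meson
  then obtain C where C: "countable C" "C \<subseteq> atlas M" "\<Union>(cdom ` C) = topspace (mtop M)"
    using countable_subset_image[of \<V> cdom "atlas M"] by auto
  \<comment> \<open>\<open>from_nat_into\<close> enumerates exactly a countable set only if it is
    nonempty, and \<open>C\<close> may be empty over an empty manifold.\<close>
  let ?C = "insert \<kappa> C"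
  have range: "range (from_nat_into ?C) = ?C" using C(1) by (intro range_from_nat_into) auto
  have "cdom \<kappa> \<subseteq> topspace (mtop M)" using openin_subset[OF openin_cdom[OF M assms]] .
  then have "\<Union>(cdom ` range (from_nat_into ?C)) = topspace (mtop M)"
    unfolding range using C(3) by auto
  then have "range (from_nat_into ?C) \<subseteq> atlas M \<and> (\<Union>n. cdom (from_nat_into ?C n)) = topspace (mtop M)"
    using C(2) assms range unfolding image_image by simp
  then have "range (chart_cover M) \<subseteq> atlas M \<and> (\<Union>n. cdom (chart_cover M n)) = topspace (mtop M)"
    unfolding chart_cover_def
    by (rule someI[of "\<lambda>C. range C \<subseteq> atlas M \<and> (\<Union>n. cdom (C n)) = topspace (mtop M)"])
  then show "chart_cover M n \<in> atlas M" "(\<Union>n. cdom (chart_cover M n)) = topspace (mtop M)" by auto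
qed

text \<open>The twist contributes the sign of the Jacobian determinant and the alternating 3-form
  the determinant itself; their product is the absolute value in the change of variables.\<close>

lemma coefficient3_transform:
  assumes \<omega>: "\<omega> \<in> forms M Twisted 3"
    and \<kappa>: "\<kappa> \<in> atlas M" "\<kappa>' \<in> atlas M" and p: "p \<in> cdom \<kappa>" "p \<in> cdom \<kappa>'"
  shows "coefficient3 (\<omega> \<kappa> (cmap \<kappa> p)) =
    \<bar>det (matrix (jacobian \<kappa> \<kappa>' (cmap \<kappa> p)))\<bar> * coefficient3 (\<omega> \<kappa>' (cmap \<kappa>' p))"
proof -
  let ?J = "jacobian \<kappa> \<kappa>' (cmap \<kappa> p)" and ?\<eta> = "\<omega> \<kappa>' (cmap \<kappa>' p)"
  have "linear ?J" using p by (intro linear_jacobian[OF M \<kappa>]) auto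
  moreover have "alternating 3 ?\<eta>" using p by (intro form_alternating[OF \<omega> \<kappa>(2)]) auto
  ultimately have "?\<eta> [?J (axis 1 1), ?J (axis 2 1), ?J (axis 3 1)] = det (matrix ?J) * coefficient3 ?\<eta>"
    by (intro alternating_3_eq_det)
  then have "coefficient3 (\<omega> \<kappa> (cmap \<kappa> p)) = orient Twisted ?J * (det (matrix ?J) * coefficient3 ?\<eta>)"
    unfolding coefficient3_def[of "\<omega> \<kappa> (cmap \<kappa> p)"] form_transform[OF \<omega> \<kappa> p] by simp
  moreover have "orient Twisted ?J * det (matrix ?J) = \<bar>det (matrix ?J)\<bar>"
    by (simp add: orient_def sgn_if)
  ultimately show ?thesis by (simp only: mult.assoc[symmetric])
qed

text \<open>The substitution maps the image of \<open>A\<close> under \<open>\<kappa>\<close> onto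
  its image under \<open>\<kappa>'\<close>. Hence measurability is asked on the side of
  \<open>\<kappa>\<close> and integrability on the side of \<open>\<kappa>'\<close>.\<close>

lemma chart_integral_transform:
  assumes \<omega>: "\<omega> \<in> forms M Twisted 3"
    and \<kappa>: "\<kappa> \<in> atlas M" "\<kappa>' \<in> atlas M" and A: "A \<subseteq> cdom \<kappa>" "A \<subseteq> cdom \<kappa>'"
    and meas: "cmap \<kappa> ` A \<in> sets lebesgue" and int: "chart_integrable \<kappa>' A \<omega>"
  shows "chart_integrable \<kappa> A \<omega>" "chart_integral \<kappa> A \<omega> = chart_integral \<kappa>' A \<omega>"
    "chart_integral \<kappa> A (\<lambda>\<kappa> x vs. \<bar>\<omega> \<kappa> x vs\<bar>) = chart_integral \<kappa>' A (\<lambda>\<kappa> x vs. \<bar>\<omega> \<kappa> x vs\<bar>)"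
proof -
  let ?T = "transition \<kappa> \<kappa>'" and ?S = "cmap \<kappa> ` A"
  have der: "(?T has_derivative jacobian \<kappa> \<kappa>' x) (at x within ?S)" if "x \<in> ?S" for x
    by (rule has_derivative_at_withinI, rule transition_has_derivative[OF M \<kappa>]) (use that A in auto)
  have T: "?T (cmap \<kappa> p) = cmap \<kappa>' p" if "p \<in> A" for p
    using that A transition_cmap[OF M \<kappa>(1)] by blast
  have inj: "inj_on ?T ?S"
    using inj_on_subset[OF inj_cmap[OF M \<kappa>(2)] A(2)] T by (auto simp: inj_on_def)
  have img: "?T ` ?S = cmap \<kappa>' ` A" using T by (force simp: image_image)
  have coeff: "coefficient3 (\<omega> \<kappa> x) = \<bar>det (matrix (jacobian \<kappa> \<kappa>' x))\<bar> * coefficient3 (\<omega> \<kappa>' (?T x))"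
    if "x \<in> ?S" for x
    using that A T coefficient3_transform[OF \<omega> \<kappa>] by force
  note cv = set_integral_change_of_variables_real[OF meas der inj, unfolded img]
  show "chart_integrable \<kappa> A \<omega>" "chart_integral \<kappa> A \<omega> = chart_integral \<kappa>' A \<omega>"
    using cv[OF _ coeff] int unfolding chart_integrable_def chart_integral_def by simp_all
  show "chart_integral \<kappa> A (\<lambda>\<kappa> x vs. \<bar>\<omega> \<kappa> x vs\<bar>) = chart_integral \<kappa>' A (\<lambda>\<kappa> x vs. \<bar>\<omega> \<kappa> x vs\<bar>)"
    unfolding chart_integral_abs
    using int unfolding chart_integrable_def
    by (intro cv(2) set_integrable_abs) (simp_all add: coeff abs_mult)
qed

text \<open>Within a chart domain a piece is an open set minus a finite union of open sets. Charts
  send open sets to open sets, and injectivity lets the image pass through the difference.\<close>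

lemma chart_image_piece_measurable:
  assumes \<kappa>: "\<kappa> \<in> atlas M" "\<kappa>' \<in> atlas M"
  shows "cmap \<kappa> ` (cdom \<kappa> \<inter> (cdom \<kappa>' \<inter> piece M n)) \<in> sets lebesgue"
proof -
  let ?C = "chart_cover M"
  let ?U = "cdom \<kappa>' \<inter> cdom (?C n)" and ?V = "\<Union>i\<in>{0..<n}. cdom (?C i)"
  have op: "openin (mtop M) (cdom (?C i))" for i
    by (rule openin_cdom[OF M chart_cover_exhausts(1)[OF \<kappa>(1)]])
  then have U: "openin (mtop M) ?U" and V: "openin (mtop M) ?V"
    using openin_cdom[OF M \<kappa>(2)] by (auto intro!: openin_Int)
  have "cdom \<kappa> \<inter> (cdom \<kappa>' \<inter> piece M n) = (cdom \<kappa> \<inter> ?U) - (cdom \<kappa> \<inter> ?V)"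
    by (auto simp: piece_def disjointed_def)
  then have "cmap \<kappa> ` (cdom \<kappa> \<inter> (cdom \<kappa>' \<inter> piece M n)) = cmap \<kappa> ` (cdom \<kappa> \<inter> ?U) - cmap \<kappa> ` (cdom \<kappa> \<inter> ?V)"
    using inj_on_image_set_diff[OF inj_cmap[OF M \<kappa>(1)], of "cdom \<kappa> \<inter> ?U" "cdom \<kappa> \<inter> ?V"] by auto
  moreover have "cmap \<kappa> ` (cdom \<kappa> \<inter> ?U) \<in> sets borel" "cmap \<kappa> ` (cdom \<kappa> \<inter> ?V) \<in> sets borel"
    using open_cmap_image[OF M \<kappa>(1)] U V by (auto intro: borel_open)
  ultimately show ?thesis by auto
qed

text \<open>The domain of \<open>\<kappa>\<close> is cut along the pieces; each integral moves from
  the chart selected for its piece to \<open>\<kappa>\<close>, where countable additivity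
  reassembles \<open>cimg \<kappa>\<close>.\<close>

lemma form_integral_cdom:
  assumes \<omega>: "\<omega> \<in> forms M Twisted 3" and int: "form_integrable M (topspace (mtop M)) \<omega>" and \<kappa>: "\<kappa> \<in> atlas M"
  shows "chart_integrable \<kappa> (cdom \<kappa>) \<omega>" "form_integral M (cdom \<kappa>) \<omega> = chart_integral \<kappa> (cdom \<kappa>) \<omega>"
proof -
  let ?C = "chart_cover M" and ?E = "\<lambda>n. cdom \<kappa> \<inter> piece M n"
  let ?abs = "\<lambda>\<kappa> x vs. \<bar>\<omega> \<kappa> x vs\<bar>"
  note C = chart_cover_exhausts[OF \<kappa>]
  have piece_sub: "piece M n \<subseteq> cdom (?C n)" for n
    unfolding piece_def by (rule disjointed_subset)
  have E_sub: "?E n \<subseteq> topspace (mtop M) \<inter> piece M n" for n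
    using openin_subset[OF openin_cdom[OF M \<kappa>]] by blast
  have meas: "cmap \<kappa> ` ?E n \<in> sets lebesgue" "cmap (?C n) ` ?E n \<in> sets lebesgue" for n
  proof -
    have "cdom \<kappa> \<inter> (cdom \<kappa> \<inter> piece M n) = ?E n" "cdom (?C n) \<inter> (cdom \<kappa> \<inter> piece M n) = ?E n"
      using piece_sub[of n] by auto
    then show "cmap \<kappa> ` ?E n \<in> sets lebesgue" "cmap (?C n) ` ?E n \<in> sets lebesgue"
      using chart_image_piece_measurable[OF \<kappa> \<kappa>, of n] chart_image_piece_measurable[OF C(1) \<kappa>, of n n] by simp_all
  qed
  have int_top: "chart_integrable (?C n) (topspace (mtop M) \<inter> piece M n) \<omega>" for n
    using int by (simp add: form_integrable_def)
  then have int_C: "chart_integrable (?C n) (?E n) \<omega>" for n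
    unfolding chart_integrable_def
    by (rule set_integrable_subset[OF _ meas(2)]) (use E_sub in blast)
  have E: "?E n \<subseteq> cdom \<kappa>" "?E n \<subseteq> cdom (?C n)" for n using piece_sub by auto
  note tr = chart_integral_transform[OF \<omega> \<kappa> C(1) E meas(1) int_C]
  \<comment> \<open>Once moved to the chart of the piece, the integral is dominated by that over the
    whole piece, and these are summable by \<open>form_integrable\<close>.\<close>
  have bound: "chart_integral \<kappa> (?E n) ?abs \<le> chart_integral (?C n) (topspace (mtop M) \<inter> piece M n) ?abs" for n
  proof -
    have "chart_integral (?C n) (?E n) ?abs \<le> chart_integral (?C n) (topspace (mtop M) \<inter> piece M n) ?abs"
      unfolding chart_integral_abs set_lebesgue_integral_def
      using E_sub[of n]
      by (intro integral_mono set_integrable_abs[unfolded set_integrable_def]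
          int_C[unfolded chart_integrable_def set_integrable_def]
          int_top[unfolded chart_integrable_def set_integrable_def])
        (auto split: split_indicator)
    then show ?thesis by (simp add: tr(3))
  qed
  have nonneg: "0 \<le> chart_integral \<kappa> (?E n) ?abs" for n
    using order_trans[OF abs_ge_zero abs_chart_integral_le[OF tr(1)]] .
  have summable: "summable (\<lambda>n. chart_integral \<kappa> (?E n) ?abs)"
    using int unfolding form_integrable_def
    by - (rule summable_comparison_test'[where N = 0], use bound nonneg in auto)
  have "(\<Union>n. piece M n) = topspace (mtop M)"
    unfolding piece_def UN_disjointed_eq by (rule C(2))
  then have "(\<Union>n. ?E n) = cdom \<kappa>"
    using openin_subset[OF openin_cdom[OF M \<kappa>]] by blast
  then have UN: "(\<Union>n. cmap \<kappa> ` ?E n) = cimg \<kappa>"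
    by (simp only: image_UN[symmetric])
  have disj: "cmap \<kappa> ` ?E i \<inter> cmap \<kappa> ` ?E j = {}" if "i \<noteq> j" for i j
  proof -
    have "piece M i \<inter> piece M j = {}"
      unfolding piece_def by (rule disjoint_family_onD[OF disjoint_family_disjointed UNIV_I UNIV_I that])
    then have "?E i \<inter> ?E j = {}" by blast
    then show ?thesis
      by (simp only: inj_on_image_Int[OF inj_cmap[OF M \<kappa>] E(1) E(1), symmetric] image_empty)
  qed
  note UN_int = set_integrable_disjoint_UN set_integral_disjoint_UN
  note * = UN_int[OF disj tr(1)[unfolded chart_integrable_def] summable[unfolded chart_integral_abs], unfolded UN]
  show "chart_integrable \<kappa> (cdom \<kappa>) \<omega>" using *(1) by (simp add: chart_integrable_def)
  show "form_integral M (cdom \<kappa>) \<omega> = chart_integral \<kappa> (cdom \<kappa>) \<omega>"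
    using *(2) by (simp add: form_integral_def tr(2)[symmetric]) (simp add: chart_integral_def)
qed

text \<open>The sum runs over all index triples. Antisymmetrization takes place inside
  \<open>dxdxdx\<close>, so the bare derivatives of the components appear, without a combinatorial
  factor.\<close>

lemma wedge_ext_deriv_components:
  assumes \<alpha>: "has_components \<alpha> \<kappa> a" and \<beta>: "has_components \<beta> \<kappa> b" and form: "\<beta> \<in> forms M s 1"
    and \<kappa>: "\<kappa> \<in> atlas M" "x \<in> cimg \<kappa>"
  shows "wedge_form 1 2 \<alpha> (ext_deriv M \<beta>) \<kappa> x vs =
    (\<Sum>i\<in>UNIV. \<Sum>j\<in>UNIV. \<Sum>k\<in>UNIV. a i x * partial_deriv j (b k) x * dxdxdx i j k vs)"
proof (cases "length vs = 3")
  case True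
  then obtain u v w where vs: "vs = [u, v, w]" using length_3_cases by blast
  have \<alpha>_eq: "\<alpha> \<kappa> x [u] = (\<Sum>i\<in>UNIV. a i x * u $ i)" for u
    using bspec[OF \<alpha>[unfolded has_components_def] \<kappa>(2)] by (simp add: dx_def)
  have \<beta>_eq: "\<beta> \<kappa> y [u] = (\<Sum>i\<in>UNIV. b i y * u $ i)" if "y \<in> cimg \<kappa>" for u y
    using bspec[OF \<beta>[unfolded has_components_def] that] by (simp add: dx_def)
  \<comment> \<open>Differentiability of \<open>b k\<close> is inherited from
    \<open>\<beta>\<close>, with which it agrees only on the open set
    \<open>cimg \<kappa>\<close>.\<close>
  have "b k y = \<beta> \<kappa> y [axis k 1]" if "y \<in> cimg \<kappa>" for k y
    using \<beta>_eq[OF that, of "axis k 1"] by (simp add: axis_def if_distrib[of "(*) _"] cong: if_cong)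
  then have b_diff: "b k differentiable (at x)" for k
    using differentiable_cong_open[OF open_cimg[OF M \<kappa>(1)] \<kappa>(2), of "b k" "\<lambda>y. \<beta> \<kappa> y [axis k 1]"]
      smooth_on_imp_differentiable[OF form_smooth[OF form \<kappa>(1)] \<kappa>(2)] by blast
  have d: "frechet_derivative (\<lambda>y. \<beta> \<kappa> y [v]) (at x) u = (\<Sum>k\<in>UNIV. (\<Sum>j\<in>UNIV. u $ j * partial_deriv j (b k) x) * v $ k)" for u v
  proof -
    have "((\<lambda>y. \<Sum>k\<in>UNIV. b k y * v $ k) has_derivative
        (\<lambda>u. \<Sum>k\<in>UNIV. frechet_derivative (b k) (at x) u * v $ k)) (at x)"
      using b_diff unfolding frechet_derivative_works by (auto intro!: derivative_eq_intros)
    then have "((\<lambda>y. \<beta> \<kappa> y [v]) has_derivative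
        (\<lambda>u. \<Sum>k\<in>UNIV. frechet_derivative (b k) (at x) u * v $ k)) (at x)"
      by (rule has_derivative_transform_within_open[OF _ open_cimg[OF M \<kappa>(1)] \<kappa>(2)]) (simp add: \<beta>_eq)
    then show ?thesis
      by (simp add: frechet_derivative_at[symmetric] frechet_derivative_eq_sum_partial_deriv b_diff)
  qed
  have "wedge_form 1 2 \<alpha> (ext_deriv M \<beta>) \<kappa> x [u, v, w] =
      \<alpha> \<kappa> x [u] * ext_deriv M \<beta> \<kappa> x [v, w] - \<alpha> \<kappa> x [v] * ext_deriv M \<beta> \<kappa> x [u, w]
      + \<alpha> \<kappa> x [w] * ext_deriv M \<beta> \<kappa> x [u, v]"
    unfolding wedge_form_def using \<kappa> by (intro wedge_1_2 ext_deriv_swap[OF M])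
  then show ?thesis
    unfolding vs by (simp add: ext_deriv_1[OF M \<kappa>] d \<alpha>_eq dxdxdx_eq sum_3 algebra_simps)
next
  case False
  then show ?thesis by (simp add: wedge_form_def dxdxdx_def wedge_def)
qed

end

theorem proposition10:
  fixes M :: "'a manifold3" and c :: real
    and F G :: "'a functional"
    and D B :: "'a vector_field"
    and d b \<theta> :: "'a form_field"
    and FD FB GD GB :: "'a chart \<Rightarrow> 3 \<Rightarrow> real^3 \<Rightarrow> real"
  assumes "riemannian_manifold3 M"
    and "c > 0"
    and "D \<in> vector_fields M Straight"
    and "B \<in> vector_fields M Twisted"
    and "d = interior_prod D (vol3 M)"
    and "b = interior_prod B (vol3 M)"
    and "functionally_differentiable M F d b"
    and "functionally_differentiable M G d b"
    and "form_integrable M (topspace (mtop M))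
           (wedge_form 1 2 (deriv_d M F d b) (ext_deriv M (deriv_b M G d b)))"
    and "form_integrable M (topspace (mtop M))
           (wedge_form 1 2 (deriv_d M G d b) (ext_deriv M (deriv_b M F d b)))"
    and "\<And>\<kappa>. \<kappa> \<in> atlas M \<Longrightarrow> has_components (deriv_d M F d b) \<kappa> (FD \<kappa>)"
    and "\<And>\<kappa>. \<kappa> \<in> atlas M \<Longrightarrow> has_components (deriv_b M F d b) \<kappa> (FB \<kappa>)"
    and "\<And>\<kappa>. \<kappa> \<in> atlas M \<Longrightarrow> has_components (deriv_d M G d b) \<kappa> (GD \<kappa>)"
    and "\<And>\<kappa>. \<kappa> \<in> atlas M \<Longrightarrow> has_components (deriv_b M G d b) \<kappa> (GB \<kappa>)"
    and "\<theta> = local_form M (\<lambda>\<kappa> x vs. \<Sum>i\<in>UNIV. \<Sum>j\<in>UNIV. \<Sum>k\<in>UNIV.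
               (FD \<kappa> i x * partial_deriv j (GB \<kappa> k) x - GD \<kappa> i x * partial_deriv j (FB \<kappa> k) x)
                 * dxdxdx i j k vs)"
  shows "\<theta> \<in> forms M Twisted 3 \<and>
     form_integrable M (topspace (mtop M)) \<theta> \<and>
     bracket M c F G d b = 4 * pi * c * form_integral M (topspace (mtop M)) \<theta> \<and>
     (\<forall>\<kappa>\<in>atlas M.
        bracket_on M (cdom \<kappa>) c F G d b = 4 * pi * c * chart_integral \<kappa> (cdom \<kappa>) \<theta>)"
proof -
  have M: "smooth_manifold3 M" using assms(1) by (simp add: riemannian_manifold3_def)
  let ?w = "\<lambda>F G. wedge_form 1 2 (deriv_d M F d b) (ext_deriv M (deriv_b M G d b))"
  \<comment> \<open>\<open>functional_derivs\<close> is a choice; differentiability guarantees that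
    the chosen pair lies in the two spaces of forms.\<close>
  have derivs: "deriv_d M H d b \<in> forms M Straight 1 \<and> deriv_b M H d b \<in> forms M Twisted 1"
    if "functionally_differentiable M H d b" for H
  proof -
    from that obtain p where "has_functional_derivs M H d b (fst p) (snd p)"
      by (auto simp: functionally_differentiable_def)
    then have "has_functional_derivs M H d b (deriv_d M H d b) (deriv_b M H d b)"
      unfolding deriv_d_def deriv_b_def functional_derivs_def
      by (rule someI[of "\<lambda>p. has_functional_derivs M H d b (fst p) (snd p)"])
    then show ?thesis by (simp add: has_functional_derivs_def)
  qed
  note dF = derivs[OF assms(7), THEN conjunct1] derivs[OF assms(7), THEN conjunct2]
    and dG = derivs[OF assms(8), THEN conjunct1] derivs[OF assms(8), THEN conjunct2]
  have forms: "?w F G \<in> forms M Twisted 3" "?w G F \<in> forms M Twisted 3"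
    by (fact wedge_ext_deriv_forms[OF M dF(1) dG(2)], fact wedge_ext_deriv_forms[OF M dG(1) dF(2)])
  \<comment> \<open>For all arguments, not just on the charts of the atlas: if the atlas is empty, \<open>chart_cover\<close>
    need not consist of such charts.\<close>
  have \<theta>: "\<theta> = (\<lambda>\<kappa> x vs. ?w F G \<kappa> x vs - ?w G F \<kappa> x vs)"
  proof (intro ext)
    fix \<kappa> x vs
    show "\<theta> \<kappa> x vs = ?w F G \<kappa> x vs - ?w G F \<kappa> x vs"
    proof (cases "\<kappa> \<in> atlas M \<and> x \<in> cimg \<kappa>")
      case True
      then have \<kappa>: "\<kappa> \<in> atlas M" and x: "x \<in> cimg \<kappa>" by auto
      have FG: "?w F G \<kappa> x vs = (\<Sum>i\<in>UNIV. \<Sum>j\<in>UNIV. \<Sum>k\<in>UNIV.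
          FD \<kappa> i x * partial_deriv j (GB \<kappa> k) x * dxdxdx i j k vs)"
        by (rule wedge_ext_deriv_components[OF M assms(11,14)[OF \<kappa>] dG(2) \<kappa> x])
      have GF: "?w G F \<kappa> x vs = (\<Sum>i\<in>UNIV. \<Sum>j\<in>UNIV. \<Sum>k\<in>UNIV.
          GD \<kappa> i x * partial_deriv j (FB \<kappa> k) x * dxdxdx i j k vs)"
        by (rule wedge_ext_deriv_components[OF M assms(13,12)[OF \<kappa>] dF(2) \<kappa> x])
      have "\<theta> \<kappa> x vs = (\<Sum>i\<in>UNIV. \<Sum>j\<in>UNIV. \<Sum>k\<in>UNIV.
          (FD \<kappa> i x * partial_deriv j (GB \<kappa> k) x - GD \<kappa> i x * partial_deriv j (FB \<kappa> k) x) * dxdxdx i j k vs)"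
        unfolding assms(15) local_form_def by (simp only: if_P[OF True])
      then show ?thesis
        unfolding FG GF by (simp only: left_diff_distrib sum_subtractf)
    next
      case False
      then show ?thesis
        unfolding form_eq_0[OF forms(1) False] form_eq_0[OF forms(2) False] assms(15) local_form_def
        by (simp only: if_False diff_self)
    qed
  qed
  have bracket_eq: "bracket_on M A c F G d b = 4 * pi * c * (form_integral M A (?w F G) - form_integral M A (?w G F))" for A
    by (simp add: bracket_on_def pairing_on_def)
  \<comment> \<open>The two wedge forms are integrable separately, so each integral is moved to
    \<open>\<kappa>\<close> by itself and the difference is taken in that chart.\<close>
  have "bracket_on M (cdom \<kappa>) c F G d b = 4 * pi * c * chart_integral \<kappa> (cdom \<kappa>) \<theta>" if "\<kappa> \<in> atlas M" for \<kappa>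
  proof -
    note FG = form_integral_cdom[OF M forms(1) assms(9) that]
      and GF = form_integral_cdom[OF M forms(2) assms(10) that]
    show ?thesis unfolding bracket_eq FG(2) GF(2) \<theta> chart_integral_diff(2)[OF FG(1) GF(1)] ..
  qed
  moreover have "\<theta> \<in> forms M Twisted 3"
    unfolding \<theta> by (rule forms_diff[OF M forms])
  moreover have "form_integrable M (topspace (mtop M)) \<theta>"
    "bracket M c F G d b = 4 * pi * c * form_integral M (topspace (mtop M)) \<theta>"
    unfolding \<theta> bracket_eq form_integral_diff(2)[OF assms(9,10)]
    by (rule form_integral_diff(1)[OF assms(9,10)]) (rule refl)
  ultimately show ?thesis by blast
qed

end
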